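(* Let $F=\mathbb{K}(x,y)$ be the function field defined by $y^q+y=x^m+x^{-m}$, and let $H=\mathbb{K}(x^{m(q-1)})$. Then the Galois closure of $F|H$ is $\mathbb{K}(x,y,z)$ with $$y^q+y=x^m+\frac{1}{x^m},\qquad z^q+z=x^m.$$
   Context: Here $p$ is an odd prime, $q=p^h$ with $h\ge 1$, $\mathbb{K}$ is the algebraic closure of $\mathbb{F}_q$, $m\ge 1$ is an integer prime to $p$, and $x$ is transcendental over $\mathbb{K}$.
   Formalization: The case q = 3 is excluded: there F|H is already Galois (x→ζx, y→ζ^m y+c with ζ^{2m}=1, c^3+c=0 give all 6m automorphisms), so the Galois closure is F itself, not K(x,y,z), and the claim fails for every m. *)

theory Defs
  imports "HOL-Computational_Algebra.Primes" "HOL-Algebra.Algebraic_Closure" "HOL-Algebra.Generated_Fields"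
begin

(* Splitting and root multiplicities are taken in the top field M, whose carrier is
   the field of interest. The library's splitted_on is not usable for this, because it
   intersects with mset_set, which is empty for an infinite set. *)
locale algebraic_extension = field M + subfield H M for M (structure) and H +
  assumes algebraic: "a \<in> carrier M \<Longrightarrow> (algebraic over H) a"

locale normal_extension = algebraic_extension +
  assumes normal: "a \<in> carrier M \<Longrightarrow> splitted (Irr H a)"

(* For a normal extension all roots of a minimal polynomial lie in M, so the second
   condition says that minimal polynomials have only simple roots. *)
locale galois_extension = normal_extension +
  assumes separable: "\<lbrakk> a \<in> carrier M; b \<in> carrier M \<rbrakk> \<Longrightarrow> alg_mult (Irr H a) b \<le> 1"

(* M is the smallest subfield of the ambient field L that contains F and is Galois over H. *)
definition is_galois_closure ::
    "('a, 'b) ring_scheme \<Rightarrow> 'a set \<Rightarrow> 'a set \<Rightarrow> 'a set \<Rightarrow> bool"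
  where "is_galois_closure L H F M \<longleftrightarrow>
    subfield M L \<and> F \<subseteq> M \<and> galois_extension (L \<lparr> carrier := M \<rparr>) H \<and>
    (\<forall>E. subfield E L \<longrightarrow> F \<subseteq> E \<longrightarrow> galois_extension (L \<lparr> carrier := E \<rparr>) H \<longrightarrow> M \<subseteq> E)"

end

theory Submission
  imports Defs
begin

text \<open>
Write \<open>t = x^m\<close>, \<open>n = m(q - 1)\<close> and \<open>u = x^n = t^(q - 1)\<close>, so that \<open>H = K(u)\<close>, and replace \<open>y\<close> by
\<open>w = y - z\<close>, which satisfies \<open>w^q + w = 1/t\<close>. The field in question is \<open>M = K(x, y, z) = H(x, z, w)\<close>.

\<open>M\<close> is Galois over \<open>H\<close>. The elements \<open>x\<close>, \<open>z\<close>, \<open>w\<close> are roots of \<open>X^n - u\<close>, \<open>(X^q + X)^(q - 1) - u\<close> and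
\<open>(X^q + X)^(q - 1) - 1/u\<close>, whose coefficients lie in \<open>H\<close>. Each of these polynomials has as many roots
in \<open>M\<close> as its degree: the first one has the roots \<open>\<zeta>x\<close> with \<open>\<zeta>\<close> an \<open>n\<close>-th root of unity (there are \<open>n\<close> of
them because \<open>n\<close> is prime to \<open>p\<close>), the other two have the roots \<open>az + e\<close> and \<open>aw + e\<close> with
\<open>a\<close> a nonzero element of \<open>Fq\<close> and \<open>e^q + e = 0\<close>
(lemmas \<open>sep_split_over_kummer\<close>, \<open>sep_split_over_artin_schreier\<close>). A field generated over \<open>H\<close> by finitely
many such elements is Galois over \<open>H\<close> (theorem \<open>galois_extension_generated\<close>). Indeed every
embedding over \<open>H\<close> of an intermediate field into \<open>M\<close> extends to all of \<open>M\<close>; hence an element which all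
embeddings \<open>M \<rightarrow> M\<close> over \<open>H\<close> fix lies in \<open>H\<close>; hence for \<open>a\<close> in \<open>M\<close> the product of the \<open>X - b\<close>, with \<open>b\<close>
running through the finite orbit of \<open>a\<close>, has coefficients in \<open>H\<close>, and the minimal polynomial of \<open>a\<close>
divides it.

\<open>M\<close> is the smallest such field. Let \<open>E\<close> contain \<open>K(x, y)\<close> and be Galois over \<open>H\<close>. Since \<open>q > 3\<close>, some
nonzero \<open>a\<close> in \<open>Fq\<close> differs from its inverse; choose \<open>\<zeta>\<close> in \<open>K\<close> with \<open>\<zeta>^m = a\<close>, so that \<open>\<zeta>^n = 1\<close>. As \<open>x\<close> is
transcendental over \<open>K\<close>, the substitution \<open>x \<mapsto> \<zeta>x\<close> is an embedding of \<open>K(x)\<close> over \<open>K\<close>. It fixes \<open>u\<close>, hence \<open>H\<close>, and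
extends to an embedding \<open>\<tau>\<close> of \<open>M\<close> over \<open>H\<close>. The conjugate \<open>r = \<tau>(y)\<close> of \<open>y\<close> lies in the normal extension
\<open>E\<close>, and \<open>r^q + r = at + 1/(at)\<close>. Therefore \<open>s = r - y/a\<close> lies in \<open>E\<close> and satisfies
\<open>s^q + s = (a - 1/a)t\<close>, and \<open>z\<close> differs from \<open>s/(a - 1/a)\<close> by a root of \<open>X^q + X\<close>. All those roots are in
\<open>K\<close>, so \<open>z\<close> is in \<open>E\<close>.

The additivity of \<open>r \<mapsto> r^q\<close> is obtained from \<open>a^q = a\<close> on \<open>Fq\<close> by comparing monic polynomials of
degree \<open>q\<close> at \<open>q\<close> points, without binomial coefficients (lemma \<open>frobenius_add\<close>).
\<close>

context field
begin

section \<open>Polynomials that split with simple roots\<close>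

text \<open>
Roots are sought in the ambient field itself. For a polynomial over a subfield \<open>H\<close> this is the
condition that a Galois extension imposes on minimal polynomials over \<open>H\<close>.
\<close>

definition sep_split :: "'a list \<Rightarrow> bool"
  where "sep_split p \<longleftrightarrow>
    p \<in> carrier (poly_ring R) \<and> p \<noteq> [] \<and> splitted p \<and> (\<forall>a. alg_mult p a \<le> 1)"

lemma set_mset_roots:
  assumes "p \<in> carrier (poly_ring R)"
  shows "set_mset (roots p) = {a. is_root p a}"
  using roots_mem_iff_is_root[OF assms] by blast

lemma card_set_mset_le_size: "card (set_mset M) \<le> size M"
proof (induction M)
  case (add a M)
  then show ?case by (simp add: card_insert_if)
qed simp

lemma card_roots_le_degree:
  assumes "p \<in> carrier (poly_ring R)"
  shows "card {a. is_root p a} \<le> degree p"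
  using card_set_mset_le_size[of "roots p"] size_roots_le_degree[OF assms]
  by (simp add: set_mset_roots[OF assms])

text \<open>
The number of distinct roots is at most the number of roots with multiplicity, which is at most the
degree. If the two ends agree, no root is missing and none is repeated.
\<close>

lemma sep_splitI:
  assumes p: "p \<in> carrier (poly_ring R)" "p \<noteq> []"
    and card: "degree p \<le> card {a. is_root p a}"
  shows "sep_split p"
proof -
  let ?S = "set_mset (roots p)"
  have S: "card ?S = size (roots p)" and deg: "size (roots p) = degree p"
    using card card_set_mset_le_size[of "roots p"] size_roots_le_degree[OF p(1)]
    by (simp_all add: set_mset_roots[OF p(1)])
  have "mset_set ?S \<subseteq># roots p"
    by (rule mset_set_set_mset_msubset)
  then have "roots p = mset_set ?S"
    using S by (metis size_mset_set mset_subset_size subset_mset.le_imp_less_or_eq less_irrefl)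
  then have "count (roots p) a \<le> 1" for a
    by (metis count_mset_set(1,3) finite_set_mset le_numeral_extra(4) zero_le_one)
  then show ?thesis
    using p deg by (simp add: sep_split_def splitted_def alg_mult_eq_count_roots)
qed

lemma sep_split_card_roots:
  assumes "sep_split p"
  shows "card {a. is_root p a} = degree p"
proof -
  have p: "p \<in> carrier (poly_ring R)" and deg: "size (roots p) = degree p"
    and mult: "count (roots p) a \<le> 1" for a
    using assms by (auto simp: sep_split_def splitted_def alg_mult_eq_count_roots)
  have "count (roots p) a = count (mset_set (set_mset (roots p))) a" for a
    using mult[of a] by (metis count_eq_zero_iff count_mset_set(1,3) finite_set_mset le_neq_implies_less less_one)
  then have "roots p = mset_set (set_mset (roots p))"
    by (rule multiset_eqI)
  then show ?thesis
    using deg by (metis set_mset_roots[OF p] size_mset_set)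
qed

text \<open>
The roots of a divisor form a submultiset of the roots of the multiple, and a divisor of a product
of linear factors is one itself.
\<close>

lemma sep_split_divisor:
  assumes q: "sep_split q" and p: "p \<in> carrier (poly_ring R)" and dvd: "p pdivides q"
  shows "sep_split p"
proof -
  have q': "q \<in> carrier (poly_ring R)" "q \<noteq> []" "splitted q" "\<And>a. alg_mult q a \<le> 1"
    using q by (auto simp: sep_split_def)
  have "p \<noteq> []"
    using dvd q'(2) zero_pdivides by blast
  moreover have "alg_mult p a \<le> 1" for a
    using pdivides_imp_roots_incl[OF p q'(1,2) dvd] q'(4)[of a]
      alg_mult_eq_count_roots[OF p] alg_mult_eq_count_roots[OF q'(1)]
      mset_subset_eq_count[of "roots p" "roots q" a] by simp
  ultimately show ?thesis
    using p pdivides_imp_splitted[OF p q'(1-3) dvd] by (auto simp: sep_split_def)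
qed

section \<open>Extending embeddings of subfields\<close>

text \<open>
The universal property of the field of fractions, in the form needed to define embeddings: two
homomorphisms from a ring \<open>P\<close> into a field that have the same kernel induce a map
\<open>f a / f b \<mapsto> g a / g b\<close> on the field generated by the image of \<open>f\<close>. It is constructed as a relation \<open>Q\<close>;
equality of the kernels makes \<open>Q\<close> single-valued, and the domain of \<open>Q\<close> is a subfield.
\<close>

lemma hom_on_fractions:
  assumes P: "ring P" and f: "f \<in> ring_hom P R" and g: "g \<in> ring_hom P R"
    and ker: "\<And>a. a \<in> carrier P \<Longrightarrow> f a = \<zero> \<longleftrightarrow> g a = \<zero>"
  defines "G \<equiv> generate_field R (f ` carrier P)"
  obtains \<psi> where "\<psi> \<in> ring_hom (R\<lparr>carrier := G\<rparr>) R"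
    and "\<And>a. a \<in> carrier P \<Longrightarrow> \<psi> (f a) = g a"
proof -
  interpret P: ring P by fact
  interpret f: ring_hom_ring P R f
    using P f ring_axioms by (simp add: ring_hom_ringI2)
  interpret g: ring_hom_ring P R g
    using P g ring_axioms by (simp add: ring_hom_ringI2)
  define Q where "Q x y \<longleftrightarrow> x \<in> carrier R \<and> y \<in> carrier R \<and>
    (\<exists>a \<in> carrier P. \<exists>b \<in> carrier P. f b \<noteq> \<zero> \<and> x \<otimes> f b = f a \<and> y \<otimes> g b = g a)" for x y
  have Q_fun: "y = y'" if xy: "Q x y" "Q x y'" for x y y'
  proof -
    obtain a b a' b' where ab: "a \<in> carrier P" "b \<in> carrier P" "f b \<noteq> \<zero>" "x \<otimes> f b = f a" "y \<otimes> g b = g a"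
      and ab': "a' \<in> carrier P" "b' \<in> carrier P" "f b' \<noteq> \<zero>" "x \<otimes> f b' = f a'" "y' \<otimes> g b' = g a'"
      and c: "x \<in> carrier R" "y \<in> carrier R" "y' \<in> carrier R"
      using xy unfolding Q_def by blast
    have "f (a \<otimes>\<^bsub>P\<^esub> b' \<ominus>\<^bsub>P\<^esub> a' \<otimes>\<^bsub>P\<^esub> b) = (x \<otimes> f b) \<otimes> f b' \<ominus> (x \<otimes> f b') \<otimes> f b"
      using ab ab' by (simp add: a_minus_def)
    also have "\<dots> = \<zero>"
      using ab(2) ab'(2) c by (simp add: f.hom_closed m_ac a_minus_def r_neg)
    finally have "g (a \<otimes>\<^bsub>P\<^esub> b' \<ominus>\<^bsub>P\<^esub> a' \<otimes>\<^bsub>P\<^esub> b) = \<zero>"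
      using ker ab(1,2) ab'(1,2) by simp
    then have "g a \<otimes> g b' \<ominus> g a' \<otimes> g b = \<zero>"
      using ab(1,2) ab'(1,2) by (simp add: a_minus_def)
    then have "g a \<otimes> g b' = g a' \<otimes> g b"
      using ab(1,2) ab'(1,2) by simp
    then have "y \<otimes> (g b \<otimes> g b') = y' \<otimes> (g b \<otimes> g b')"
      using ab(2) ab'(2) c by (simp flip: ab(5) ab'(5) add: m_ac)
    moreover have "g b \<otimes> g b' \<noteq> \<zero>"
      using ab(2,3) ab'(2,3) ker by (simp add: integral_iff)
    ultimately show ?thesis
      using c ab(2) ab'(2) by (meson g.hom_closed m_closed m_rcancel)
  qed
  have Q_add: "Q (x \<oplus> x') (y \<oplus> y')" and Q_mult: "Q (x \<otimes> x') (y \<otimes> y')"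
    if xy: "Q x y" "Q x' y'" for x y x' y'
  proof -
    obtain a b a' b' where ab: "a \<in> carrier P" "b \<in> carrier P" "f b \<noteq> \<zero>" "x \<otimes> f b = f a" "y \<otimes> g b = g a"
      and ab': "a' \<in> carrier P" "b' \<in> carrier P" "f b' \<noteq> \<zero>" "x' \<otimes> f b' = f a'" "y' \<otimes> g b' = g a'"
      and c: "x \<in> carrier R" "y \<in> carrier R" "x' \<in> carrier R" "y' \<in> carrier R"
      using xy unfolding Q_def by blast
    have 1: "f (b \<otimes>\<^bsub>P\<^esub> b') \<noteq> \<zero>"
      using ab(2,3) ab'(2,3) by (simp add: integral_iff)
    have 2: "(x \<otimes> x') \<otimes> f (b \<otimes>\<^bsub>P\<^esub> b') = f (a \<otimes>\<^bsub>P\<^esub> a')" "(y \<otimes> y') \<otimes> g (b \<otimes>\<^bsub>P\<^esub> b') = g (a \<otimes>\<^bsub>P\<^esub> a')"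
      using ab(1,2) ab'(1,2) c by (simp_all flip: ab(4,5) ab'(4,5) add: m_ac)
    have 3: "(x \<oplus> x') \<otimes> f (b \<otimes>\<^bsub>P\<^esub> b') = f (a \<otimes>\<^bsub>P\<^esub> b' \<oplus>\<^bsub>P\<^esub> a' \<otimes>\<^bsub>P\<^esub> b)"
      "(y \<oplus> y') \<otimes> g (b \<otimes>\<^bsub>P\<^esub> b') = g (a \<otimes>\<^bsub>P\<^esub> b' \<oplus>\<^bsub>P\<^esub> a' \<otimes>\<^bsub>P\<^esub> b)"
      using ab(1,2) ab'(1,2) c by (simp_all flip: ab(4,5) ab'(4,5) add: l_distr r_distr m_ac)
    show "Q (x \<otimes> x') (y \<otimes> y')"
      unfolding Q_def using c 1 2 ab(1,2) ab'(1,2) by (meson P.m_closed m_closed)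
    show "Q (x \<oplus> x') (y \<oplus> y')"
      unfolding Q_def using c 1 3 ab(1,2) ab'(1,2) by (meson P.m_closed P.a_closed a_closed)
  qed
  have Q_f: "Q (f a) (g a)" if "a \<in> carrier P" for a
  proof -
    have "f \<one>\<^bsub>P\<^esub> \<noteq> \<zero>" "f a \<otimes> f \<one>\<^bsub>P\<^esub> = f a" "g a \<otimes> g \<one>\<^bsub>P\<^esub> = g a"
      using that by simp_all
    then show ?thesis
      unfolding Q_def using that P.one_closed f.hom_closed g.hom_closed by blast
  qed
  have Q_one: "Q \<one> \<one>"
    using Q_f[of "\<one>\<^bsub>P\<^esub>"] by simp
  have Q_minus: "Q (\<ominus> x) (\<ominus> y)" if "Q x y" for x y
    using Q_mult[OF Q_f[of "\<ominus>\<^bsub>P\<^esub> \<one>\<^bsub>P\<^esub>"] that] that by (simp add: l_minus Q_def)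
  have Q_inv: "Q (inv x) (inv y)" if xy: "Q x y" and nz: "x \<noteq> \<zero>" for x y
  proof -
    obtain a b where ab: "a \<in> carrier P" "b \<in> carrier P" "f b \<noteq> \<zero>" "x \<otimes> f b = f a" "y \<otimes> g b = g a"
      and c: "x \<in> carrier R" "y \<in> carrier R"
      using xy unfolding Q_def by blast
    have fa: "f a \<noteq> \<zero>"
      using ab nz c by (metis f.hom_closed integral_iff)
    then have "y \<noteq> \<zero>"
      using ab ker by (metis g.hom_closed l_null)
    then have U: "x \<in> Units R" "y \<in> Units R"
      using nz c by (simp_all add: field_Units)
    have "inv x \<otimes> f a = f b" "inv y \<otimes> g a = g b"
      using U ab(2) c by (simp_all flip: ab(4,5) m_assoc)
    then show ?thesis
      unfolding Q_def using U ab(1,2) fa by blast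
  qed
  have "subfield {x. \<exists>y. Q x y} R"
  proof (rule subfieldI')
    show "subring {x. \<exists>y. Q x y} R"
    proof (rule subringI)
      show "{x. \<exists>y. Q x y} \<subseteq> carrier R"
        by (auto simp: Q_def)
      show "\<one> \<in> {x. \<exists>y. Q x y}"
        using Q_one by blast
      show "\<ominus> x \<in> {x. \<exists>y. Q x y}" if "x \<in> {x. \<exists>y. Q x y}" for x
        using that Q_minus by blast
      fix x x' assume "x \<in> {x. \<exists>y. Q x y}" "x' \<in> {x. \<exists>y. Q x y}"
      then obtain y y' where "Q x y" "Q x' y'"
        by blast
      then show "x \<otimes> x' \<in> {x. \<exists>y. Q x y}" "x \<oplus> x' \<in> {x. \<exists>y. Q x y}"
        using Q_add Q_mult by blast+
    qed
    show "\<And>k. k \<in> {x. \<exists>y. Q x y} - {\<zero>} \<Longrightarrow> inv k \<in> {x. \<exists>y. Q x y}"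
      using Q_inv by blast
  qed
  moreover have fP: "f ` carrier P \<subseteq> carrier R"
    using f.hom_closed by blast
  moreover have "f ` carrier P \<subseteq> {x. \<exists>y. Q x y}"
    using Q_f by blast
  ultimately have Q_total: "\<exists>y. Q x y" if "x \<in> G" for x
    using generate_field_min_subfield1[OF fP, of "{x. \<exists>y. Q x y}"] that
    unfolding G_def by blast
  (* Outside G the value of \<psi> is arbitrary. *)
  define \<psi> where "\<psi> x = (SOME y. Q x y)" for x
  have \<psi>: "Q x (\<psi> x)" if "x \<in> G" for x
    unfolding \<psi>_def using Q_total[OF that] by (rule someI_ex)
  have \<psi>_eq: "\<psi> x = y" if "Q x y" for x y
    unfolding \<psi>_def by (rule some_equality) (use Q_fun that in blast)+
  have G: "subring G R"
    unfolding G_def by (intro subfieldE(1) generate_field_is_subfield fP)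
  show thesis
  proof
    show "\<psi> \<in> ring_hom (R\<lparr>carrier := G\<rparr>) R"
    proof (rule ring_hom_memI)
      show "\<psi> x \<in> carrier R" if "x \<in> carrier (R\<lparr>carrier := G\<rparr>)" for x
        using \<psi>[of x] that by (simp add: Q_def)
      show "\<psi> \<one>\<^bsub>R\<lparr>carrier := G\<rparr>\<^esub> = \<one>"
        using \<psi>_eq[OF Q_one] by simp
      fix x y assume "x \<in> carrier (R\<lparr>carrier := G\<rparr>)" "y \<in> carrier (R\<lparr>carrier := G\<rparr>)"
      then have "Q x (\<psi> x)" "Q y (\<psi> y)"
        using \<psi> by simp_all
      from \<psi>_eq[OF Q_mult[OF this]] \<psi>_eq[OF Q_add[OF this]]
      show "\<psi> (x \<otimes>\<^bsub>R\<lparr>carrier := G\<rparr>\<^esub> y) = \<psi> x \<otimes> \<psi> y"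
        and "\<psi> (x \<oplus>\<^bsub>R\<lparr>carrier := G\<rparr>\<^esub> y) = \<psi> x \<oplus> \<psi> y"
        by simp_all
    qed
    show "\<And>a. a \<in> carrier P \<Longrightarrow> \<psi> (f a) = g a"
      using Q_f \<psi>_eq by blast
  qed
qed

lemma map_poly_hom:
  assumes E: "subfield E R" and \<phi>: "\<phi> \<in> ring_hom (R\<lparr>carrier := E\<rparr>) R"
  shows "map \<phi> \<in> ring_hom (E[X]) (poly_ring R)"
proof -
  interpret E: field "R\<lparr>carrier := E\<rparr>"
    using subfield_iff(2)[OF E] .
  interpret \<phi>: ring_hom_ring "R\<lparr>carrier := E\<rparr>" R \<phi>
    using E.ring_axioms ring_axioms \<phi> by (rule ring_hom_ringI2)
  note sub = subfieldE(1)[OF E]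
  have poly: "poly_ring (R\<lparr>carrier := E\<rparr>) = E[X]"
    by (simp add: univ_poly_consistent[OF sub])
  have cl: "map \<phi> p \<in> carrier (poly_ring R)" if "p \<in> carrier (E[X])" for p
    using polynomial_hom[OF \<phi> E.field_axioms field_axioms, of p] that unfolding poly .
  have inc: "set p \<subseteq> E" if "p \<in> carrier (E[X])" for p
    using that polynomial_incl by (simp flip: univ_poly_carrier)
  have norm: "normalize (map \<phi> p) = map \<phi> p" if "p \<in> carrier (E[X])" for p
    using cl[OF that] normalize_polynomial by (simp flip: univ_poly_carrier)
  interpret UP: ring "E[X]"
    using univ_poly_is_ring[OF sub] .
  show ?thesis
  proof (rule ring_hom_memI)
    fix p q assume p: "p \<in> carrier (E[X])" and q: "q \<in> carrier (E[X])"
    show "map \<phi> (p \<otimes>\<^bsub>E[X]\<^esub> q) = map \<phi> p \<otimes>\<^bsub>poly_ring R\<^esub> map \<phi> q"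
      using \<phi>.poly_mult_hom'[of p q] inc[OF p] inc[OF q] norm[OF UP.m_closed[OF p q]]
      by (simp add: univ_poly_mult poly_mult_consistent[OF sub])
    show "map \<phi> (p \<oplus>\<^bsub>E[X]\<^esub> q) = map \<phi> p \<oplus>\<^bsub>poly_ring R\<^esub> map \<phi> q"
      using \<phi>.poly_add_hom'[of p q] inc[OF p] inc[OF q] norm[OF UP.a_closed[OF p q]]
      by (simp add: univ_poly_add poly_add_consistent[OF sub] del: poly_add.simps)
  qed (use cl \<phi>.hom_one in \<open>simp_all add: univ_poly_one\<close>)
qed

lemma eval_map_hom:
  assumes E: "subfield E R" and \<phi>: "\<phi> \<in> ring_hom (R\<lparr>carrier := E\<rparr>) R"
    and \<beta>: "\<beta> \<in> carrier R"
  shows "(\<lambda>p. eval (map \<phi> p) \<beta>) \<in> ring_hom (E[X]) R"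
  using ring_hom_trans[OF map_poly_hom[OF E \<phi>] eval_is_hom[OF carrier_is_subring \<beta>]]
  by (simp add: comp_def)

lemma generate_field_simple_extension:
  assumes E: "subfield E R" and \<alpha>: "\<alpha> \<in> carrier R"
  shows "generate_field R (simple_extension E \<alpha>) = generate_field R (insert \<alpha> E)"
proof -
  have sub: "insert \<alpha> E \<subseteq> carrier R"
    using \<alpha> subfieldE(3)[OF E] by simp
  have ext: "simple_extension E \<alpha> \<subseteq> carrier R"
    by (intro simple_extension_in_carrier subfieldE(3)[OF E] \<alpha>)
  have G: "subfield (generate_field R (insert \<alpha> E)) R"
    "insert \<alpha> E \<subseteq> generate_field R (insert \<alpha> E)"
    using generate_fieldE(1,2)[OF sub refl] .
  show ?thesis
  proof
    show "generate_field R (simple_extension E \<alpha>) \<subseteq> generate_field R (insert \<alpha> E)"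
      using simple_extension_subring_incl[OF subfieldE(1)[OF G(1)], of E \<alpha>] G(2)
      by (intro generate_field_min_subfield1[OF ext G(1)]) auto
    show "generate_field R (insert \<alpha> E) \<subseteq> generate_field R (simple_extension E \<alpha>)"
      using simple_extension_incl[OF subfieldE(3)[OF E] \<alpha>] simple_extension_mem[OF subfieldE(1)[OF E] \<alpha>]
      by (intro mono_generate_field ext) auto
  qed
qed

text \<open>
Apply \<open>hom_on_fractions\<close> to evaluation at \<open>\<alpha>\<close> and to evaluation at \<open>\<beta>\<close> after \<open>\<phi>\<close>. Both the
algebraic and the transcendental case are instances.
\<close>

lemma extend_hom_to_simple_extension:
  assumes E: "subfield E R" and \<phi>: "\<phi> \<in> ring_hom (R\<lparr>carrier := E\<rparr>) R"
    and \<alpha>: "\<alpha> \<in> carrier R" and \<beta>: "\<beta> \<in> carrier R"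
    and ker: "\<And>p. p \<in> carrier (E[X]) \<Longrightarrow> eval p \<alpha> = \<zero> \<longleftrightarrow> eval (map \<phi> p) \<beta> = \<zero>"
  obtains \<psi> where "\<psi> \<in> ring_hom (R\<lparr>carrier := generate_field R (insert \<alpha> E)\<rparr>) R"
    and "\<psi> \<alpha> = \<beta>" and "\<And>e. e \<in> E \<Longrightarrow> \<psi> e = \<phi> e"
proof -
  note sub = subfieldE(1)[OF E]
  interpret \<phi>: ring_hom_ring "R\<lparr>carrier := E\<rparr>" R \<phi>
    using subring_is_ring[OF sub] ring_axioms \<phi> by (rule ring_hom_ringI2)
  have gen: "generate_field R ((\<lambda>p. eval p \<alpha>) ` carrier (E[X])) = generate_field R (insert \<alpha> E)"
    using generate_field_simple_extension[OF E \<alpha>] simple_extension_as_eval_img[OF subfieldE(3)[OF E] \<alpha>]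
    by simp
  obtain \<psi> where \<psi>: "\<psi> \<in> ring_hom (R\<lparr>carrier := generate_field R (insert \<alpha> E)\<rparr>) R"
      "\<And>p. p \<in> carrier (E[X]) \<Longrightarrow> \<psi> (eval p \<alpha>) = eval (map \<phi> p) \<beta>"
    using hom_on_fractions[OF univ_poly_is_ring[OF sub] eval_is_hom[OF sub \<alpha>] eval_map_hom[OF E \<phi> \<beta>] ker]
    unfolding gen by blast
  have "\<psi> \<alpha> = \<beta>"
    using \<psi>(2)[OF var_closed(1)[OF sub]] \<alpha> \<beta> \<phi>.hom_zero \<phi>.hom_one by (simp add: var_def)
  moreover have "\<psi> e = \<phi> e" if e: "e \<in> E" for e
  proof (cases "e = \<zero>")
    case True
    have "[] \<in> carrier (E[X])" by (rule univ_poly_zero_closed)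
    then show ?thesis
      using \<psi>(2)[of "[]"] \<phi>.hom_zero True by simp
  next
    case False
    then have "[e] \<in> carrier (E[X])"
      using e by (simp flip: univ_poly_carrier add: const_is_polynomial)
    then show ?thesis
      using \<psi>(2)[of "[e]"] e subfieldE(3)[OF E] \<phi>.hom_closed by (simp add: subset_iff)
  qed
  ultimately show thesis
    using \<psi>(1) that by blast
qed

lemma carrier_poly_mono:
  assumes "H \<subseteq> E" shows "carrier (H[X]) \<subseteq> carrier (E[X])"
  using assms by (auto simp: univ_poly_def polynomial_def)

lemma Irr_dvd:
  assumes E: "subfield E R" and \<alpha>: "\<alpha> \<in> carrier R" "(algebraic over E) \<alpha>"
    and p: "p \<in> carrier (E[X])" "eval p \<alpha> = \<zero>"
  obtains s where "s \<in> carrier (E[X])" "p = Irr E \<alpha> \<otimes>\<^bsub>E[X]\<^esub> s"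
proof -
  have "Irr E \<alpha> divides\<^bsub>E[X]\<^esub> p"
    using Irr_minimal[OF E \<alpha> p] pdivides_iff_shell[OF E IrrE(1)[OF E \<alpha>] p(1)] by simp
  then show thesis
    using that by (auto elim!: dividesE)
qed

text \<open>
Evaluation at \<open>\<beta>\<close> after \<open>\<phi>\<close> kills every multiple of the minimal polynomial of \<open>\<alpha>\<close>. It kills nothing
else: the ring \<open>E[\<alpha>]\<close> is a field, so a polynomial not vanishing at \<open>\<alpha>\<close> has an inverse
modulo the minimal polynomial, and its value at \<open>\<beta>\<close> is a unit.
\<close>

lemma extend_hom_to_root:
  assumes E: "subfield E R" and \<phi>: "\<phi> \<in> ring_hom (R\<lparr>carrier := E\<rparr>) R"
    and \<alpha>: "\<alpha> \<in> carrier R" "(algebraic over E) \<alpha>"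
    and \<beta>: "\<beta> \<in> carrier R" "eval (map \<phi> (Irr E \<alpha>)) \<beta> = \<zero>"
  obtains \<psi> where "\<psi> \<in> ring_hom (R\<lparr>carrier := generate_field R (insert \<alpha> E)\<rparr>) R"
    and "\<psi> \<alpha> = \<beta>" and "\<And>e. e \<in> E \<Longrightarrow> \<psi> e = \<phi> e"
proof -
  note sub = subfieldE(1)[OF E]
  interpret UP: domain "E[X]"
    by (rule univ_poly_is_domain[OF sub])
  define f where "f p = eval p \<alpha>" for p
  define g where "g p = eval (map \<phi> p) \<beta>" for p
  have f_hom: "f \<in> ring_hom (E[X]) R" and g_hom: "g \<in> ring_hom (E[X]) R"
    using eval_is_hom[OF sub \<alpha>(1)] eval_map_hom[OF E \<phi> \<beta>(1)] by (simp_all add: f_def[abs_def] g_def[abs_def])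
  interpret f: ring_hom_ring "E[X]" R f
    using UP.ring_axioms ring_axioms f_hom by (rule ring_hom_ringI2)
  interpret g: ring_hom_ring "E[X]" R g
    using UP.ring_axioms ring_axioms g_hom by (rule ring_hom_ringI2)
  have fwd: "g p = \<zero>" if p: "p \<in> carrier (E[X])" "f p = \<zero>" for p
  proof -
    obtain s where "s \<in> carrier (E[X])" "p = Irr E \<alpha> \<otimes>\<^bsub>E[X]\<^esub> s"
      using Irr_dvd[OF E \<alpha> p(1)] p(2) unfolding f_def by blast
    moreover have "g (Irr E \<alpha>) = \<zero>"
      using \<beta>(2) by (simp add: g_def)
    ultimately show ?thesis
      using IrrE(1)[OF E \<alpha>] by simp
  qed
  have bwd: "f p = \<zero>" if p: "p \<in> carrier (E[X])" "g p = \<zero>" for p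
  proof (rule ccontr)
    assume nz: "f p \<noteq> \<zero>"
    have img: "simple_extension E \<alpha> = f ` carrier (E[X])"
      using simple_extension_as_eval_img[OF subfieldE(3)[OF E] \<alpha>(1)] by (simp add: f_def[abs_def])
    have "subfield (simple_extension E \<alpha>) R"
      using simple_extension_is_subfield[OF E \<alpha>(1)] \<alpha>(2) by simp
    from subfield_m_inv(1)[OF this, of "f p"]
    obtain c where c: "c \<in> carrier (E[X])" "inv (f p) = f c"
      using p nz unfolding img by blast
    have "f p \<otimes> f c = \<one>"
      using nz f.hom_closed[OF p(1)] by (simp add: field_Units flip: c(2))
    then have "f (p \<otimes>\<^bsub>E[X]\<^esub> c \<ominus>\<^bsub>E[X]\<^esub> \<one>\<^bsub>E[X]\<^esub>) = \<zero>"
      using p(1) c(1) by (simp add: a_minus_def r_neg)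
    from fwd[OF _ this] have "g (p \<otimes>\<^bsub>E[X]\<^esub> c \<ominus>\<^bsub>E[X]\<^esub> \<one>\<^bsub>E[X]\<^esub>) = \<zero>"
      using p(1) c(1) by simp
    then have "\<zero> \<ominus> \<one> = \<zero>"
      using p c(1) by (simp add: a_minus_def)
    then show False
      by simp
  qed
  have ker: "eval p \<alpha> = \<zero> \<longleftrightarrow> eval (map \<phi> p) \<beta> = \<zero>" if "p \<in> carrier (E[X])" for p
    using fwd[OF that] bwd[OF that] unfolding f_def g_def by blast
  show thesis
    using extend_hom_to_simple_extension[OF E \<phi> \<alpha>(1) \<beta>(1) ker] that by blast
qed

text \<open>
The polynomial need not be the minimal one. This makes the condition easy to check, and it
passes to minimal polynomials over every field between \<open>H\<close> and the ambient field.
\<close>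

definition sep_split_over :: "'a set \<Rightarrow> 'a \<Rightarrow> bool"
  where "sep_split_over H s \<longleftrightarrow>
    s \<in> carrier R \<and> (\<exists>g \<in> carrier (H[X]). sep_split g \<and> eval g s = \<zero>)"

lemma sep_split_over_algebraic:
  assumes "sep_split_over H s" "H \<subseteq> E"
  shows "(algebraic over E) s"
  using assms carrier_poly_mono[of H E] algebraicI[of _ E s]
  unfolding sep_split_over_def sep_split_def by blast

text \<open>
A polynomial over \<open>H\<close> that has \<open>s\<close> as a root is a multiple of the minimal polynomial of \<open>s\<close> over \<open>E\<close>, and
\<open>\<phi>\<close> does not change it. So the image of the minimal polynomial still divides it.
\<close>

lemma sep_split_map_Irr:
  assumes H: "subfield H R" and E: "subfield E R" "H \<subseteq> E"
    and \<phi>: "\<phi> \<in> ring_hom (R\<lparr>carrier := E\<rparr>) R" "\<And>h. h \<in> H \<Longrightarrow> \<phi> h = h"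
    and s: "sep_split_over H s"
  shows "sep_split (map \<phi> (Irr E s))"
proof -
  have alg: "(algebraic over E) s" and s': "s \<in> carrier R"
    using sep_split_over_algebraic[OF s E(2)] s by (auto simp: sep_split_over_def)
  obtain g where g: "g \<in> carrier (H[X])" "sep_split g" "eval g s = \<zero>"
    using s unfolding sep_split_over_def by blast
  then have gE: "g \<in> carrier (E[X])"
    using carrier_poly_mono[OF E(2)] by blast
  obtain r where r: "r \<in> carrier (E[X])" "g = Irr E s \<otimes>\<^bsub>E[X]\<^esub> r"
    using Irr_dvd[OF E(1) s' alg gE g(3)] .
  note hom = map_poly_hom[OF E(1) \<phi>(1)]
  have "set g \<subseteq> H"
    using g(1) polynomial_incl by (simp flip: univ_poly_carrier)
  then have "map \<phi> g = g"
    using \<phi>(2) by (intro map_idI) blast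
  then have "g = map \<phi> (Irr E s) \<otimes>\<^bsub>poly_ring R\<^esub> map \<phi> r"
    using ring_hom_mult[OF hom IrrE(1)[OF E(1) s' alg] r(1)] r(2) by simp
  then have "map \<phi> (Irr E s) pdivides g"
    using ring_hom_closed[OF hom r(1)] unfolding pdivides_def factor_def by blast
  then show ?thesis
    using sep_split_divisor[OF g(2)] ring_hom_closed[OF hom IrrE(1)[OF E(1) s' alg]] by blast
qed

lemma degree_Irr_pos:
  assumes "subfield E R" "s \<in> carrier R" "(algebraic over E) s"
  shows "degree (Irr E s) \<ge> 1"
  using pirreducible_degree[OF assms(1) IrrE(1,2)[OF assms]] .

lemma extend_hom_to_sep_split:
  assumes H: "subfield H R" and E: "subfield E R" "H \<subseteq> E"
    and \<phi>: "\<phi> \<in> ring_hom (R\<lparr>carrier := E\<rparr>) R" "\<And>h. h \<in> H \<Longrightarrow> \<phi> h = h"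
    and s: "sep_split_over H s"
  obtains \<psi> where "\<psi> \<in> ring_hom (R\<lparr>carrier := generate_field R (insert s E)\<rparr>) R"
    and "\<And>e. e \<in> E \<Longrightarrow> \<psi> e = \<phi> e"
proof -
  have alg: "(algebraic over E) s" and s': "s \<in> carrier R"
    using sep_split_over_algebraic[OF s E(2)] s by (auto simp: sep_split_over_def)
  have "card {b. is_root (map \<phi> (Irr E s)) b} > 0"
    using sep_split_card_roots[OF sep_split_map_Irr[OF assms]] degree_Irr_pos[OF E(1) s' alg] by simp
  then obtain b where "b \<in> carrier R" "eval (map \<phi> (Irr E s)) b = \<zero>"
    by (fastforce simp: card_gt_0_iff is_root_def)
  then show thesis
    using extend_hom_to_root[OF E(1) \<phi>(1) s' alg, of b] that by metis
qed

lemma generate_field_of_subfield: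
  assumes "subfield E R" shows "generate_field R E = E"
  using generate_fieldI[OF subfieldE(3)[OF assms] assms] by blast

lemma generate_field_generate_field_Un:
  assumes T: "T \<subseteq> carrier R" and S: "S \<subseteq> carrier R"
  shows "generate_field R (generate_field R T \<union> S) = generate_field R (T \<union> S)"
proof
  have sub: "T \<union> S \<subseteq> carrier R" "generate_field R T \<union> S \<subseteq> carrier R"
    using T S generate_field_incl[OF T] by auto
  have "generate_field R T \<subseteq> generate_field R (T \<union> S)"
    by (intro mono_generate_field sub) simp
  then show "generate_field R (generate_field R T \<union> S) \<subseteq> generate_field R (T \<union> S)"
    using generate_fieldE(1,2)[OF sub(1) refl]
    by (intro generate_field_min_subfield1[OF sub(2)]) auto
  show "generate_field R (T \<union> S) \<subseteq> generate_field R (generate_field R T \<union> S)"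
    using generate_fieldE(2)[OF T refl] by (intro mono_generate_field sub) auto
qed

lemma extend_hom_to_generated:
  assumes H: "subfield H R" and E: "subfield E R" "H \<subseteq> E"
    and \<phi>: "\<phi> \<in> ring_hom (R\<lparr>carrier := E\<rparr>) R" "\<And>h. h \<in> H \<Longrightarrow> \<phi> h = h"
    and S: "finite S" "\<And>s. s \<in> S \<Longrightarrow> sep_split_over H s"
  obtains \<psi> where "\<psi> \<in> ring_hom (R\<lparr>carrier := generate_field R (E \<union> S)\<rparr>) R"
    and "\<And>e. e \<in> E \<Longrightarrow> \<psi> e = \<phi> e"
proof -
  have "\<exists>\<psi> \<in> ring_hom (R\<lparr>carrier := generate_field R (E \<union> S)\<rparr>) R. \<forall>e \<in> E. \<psi> e = \<phi> e"
    using S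
  proof (induction S)
    case empty
    then show ?case
      using \<phi>(1) by (auto simp: generate_field_of_subfield[OF E(1)])
  next
    case (insert s S)
    define G where "G = generate_field R (E \<union> S)"
    obtain \<psi> where \<psi>: "\<psi> \<in> ring_hom (R\<lparr>carrier := G\<rparr>) R" "\<And>e. e \<in> E \<Longrightarrow> \<psi> e = \<phi> e"
      using insert.IH insert.prems unfolding G_def by blast
    have ES: "E \<union> S \<subseteq> carrier R" and s: "sep_split_over H s" "{s} \<subseteq> carrier R"
      using insert.prems subfieldE(3)[OF E(1)] by (auto simp: sep_split_over_def)
    have G: "subfield G R" "E \<union> S \<subseteq> G"
      using generate_fieldE(1,2)[OF ES G_def] .
    have "H \<subseteq> G" "\<And>h. h \<in> H \<Longrightarrow> \<psi> h = h"
      using G(2) E(2) \<psi>(2) \<phi>(2) by auto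
    from extend_hom_to_sep_split[OF H G(1) this(1) \<psi>(1) this(2) s(1)]
    obtain \<chi> where "\<chi> \<in> ring_hom (R\<lparr>carrier := generate_field R (insert s G)\<rparr>) R"
      "\<And>e. e \<in> G \<Longrightarrow> \<chi> e = \<psi> e"
      by blast
    moreover have "generate_field R (insert s G) = generate_field R (E \<union> insert s S)"
      using generate_field_generate_field_Un[OF ES s(2)] unfolding G_def by simp
    ultimately show ?case
      using G(2) \<psi>(2) by (metis Un_iff subsetD)
  qed
  then show thesis
    using that by blast
qed

text \<open>
The elements of \<open>E\<close> that \<open>\<phi>\<close> fixes form a subfield.
\<close>

lemma hom_fixes_generated:
  assumes E: "subfield E R" and \<phi>: "\<phi> \<in> ring_hom (R\<lparr>carrier := E\<rparr>) R"
    and T: "T \<subseteq> E" "\<And>t. t \<in> T \<Longrightarrow> \<phi> t = t" and h: "h \<in> generate_field R T"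
  shows "\<phi> h = h"
proof -
  note sub = subfieldE(1)[OF E]
  have ER: "E \<subseteq> carrier R"
    using subfieldE(3)[OF E] .
  interpret \<phi>: ring_hom_ring "R\<lparr>carrier := E\<rparr>" R \<phi>
    using subring_is_ring[OF sub] ring_axioms \<phi> by (rule ring_hom_ringI2)
  have "subfield {h \<in> E. \<phi> h = h} R"
  proof (rule subfieldI')
    show "subring {h \<in> E. \<phi> h = h} R"
    proof (rule subringI)
      fix a assume a: "a \<in> {h \<in> E. \<phi> h = h}"
      have "\<phi> (\<ominus> a) \<oplus> \<phi> a = \<phi> (\<ominus> a \<oplus> a)"
        using \<phi>.hom_add[of "\<ominus> a" a] a subringE(5)[OF sub] by simp
      also have "\<dots> = \<zero>"
        using a ER \<phi>.hom_zero by (auto simp: l_neg)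
      finally have "\<phi> (\<ominus> a) = \<ominus> a"
        using a ER subringE(5)[OF sub] \<phi>.hom_closed[of "\<ominus> a"] minus_equality by fastforce
      then show "\<ominus> a \<in> {h \<in> E. \<phi> h = h}"
        using a subringE(5)[OF sub] by simp
    qed (use ER \<phi>.hom_one \<phi>.hom_add \<phi>.hom_mult subringE(3,6,7)[OF sub] in auto)
    fix k assume k: "k \<in> {h \<in> E. \<phi> h = h} - {\<zero>}"
    then have kE: "k \<in> E - {\<zero>}" and kU: "k \<in> Units R"
      using ER by (auto simp: field_Units)
    have inv: "inv k \<in> E" "k \<otimes> inv k = \<one>"
      using subfield_m_inv[OF E kE] by auto
    have "k \<otimes> \<phi> (inv k) = \<phi> (k \<otimes> inv k)"
      using \<phi>.hom_mult[of k "inv k"] k inv(1) by simp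
    also have "\<dots> = \<one>"
      using inv(2) \<phi>.hom_one by simp
    finally have "\<phi> (inv k) = inv k"
      using kU inv(1) \<phi>.hom_closed[of "inv k"] comm_inv_char[of k "\<phi> (inv k)"] by auto
    then show "inv k \<in> {h \<in> E. \<phi> h = h}"
      using inv(1) by simp
  qed
  then have "generate_field R T \<subseteq> {h \<in> E. \<phi> h = h}"
    using T ER by (intro generate_field_min_subfield1) auto
  then show ?thesis
    using h by blast
qed

text \<open>
If \<open>\<zeta> x\<close> were algebraic over \<open>K\<close>, so would be its multiple \<open>x\<close>. Hence no nonzero polynomial over \<open>K\<close> vanishes
at \<open>x\<close> or at \<open>\<zeta> x\<close>.
\<close>

lemma scaling_hom:
  assumes K: "subfield K R" and x: "x \<in> carrier R" "(transcendental over K) x" and \<zeta>: "\<zeta> \<in> K" "\<zeta> \<noteq> \<zero>"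
  obtains \<phi> where "\<phi> \<in> ring_hom (R\<lparr>carrier := generate_field R (insert x K)\<rparr>) R"
    "\<phi> x = \<zeta> \<otimes> x" "\<And>k. k \<in> K \<Longrightarrow> \<phi> k = k"
proof -
  note sub = subfieldE(1)[OF K]
  have \<zeta>R: "\<zeta> \<in> carrier R" and zx: "\<zeta> \<otimes> x \<in> carrier R"
    using \<zeta>(1) subfieldE(3)[OF K] x(1) by auto
  have trans: "(transcendental over K) (\<zeta> \<otimes> x)"
  proof (rule ccontr)
    assume "\<not> (transcendental over K) (\<zeta> \<otimes> x)"
    then have alg: "(algebraic over K) (\<zeta> \<otimes> x)"
      by (simp add: over_def)
    let ?A = "{a \<in> carrier R. (algebraic over K) a}"
    have A: "subfield ?A R"
      by (rule subfield_of_algebraics[OF K])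
    have "inv \<zeta> \<in> K"
      using subfield_m_inv(1)[OF K] \<zeta> by simp
    then have "inv \<zeta> \<in> ?A"
      using algebraic_self[OF sub] subfieldE(3)[OF K] by auto
    then have "inv \<zeta> \<otimes> (\<zeta> \<otimes> x) \<in> ?A"
      using alg zx subringE(6)[OF subfieldE(1)[OF A]] by auto
    moreover have "inv \<zeta> \<otimes> (\<zeta> \<otimes> x) = x"
      using \<zeta>R \<zeta>(2) x(1) by (simp add: field_Units flip: m_assoc)
    ultimately show False
      using x(2) by (auto simp: over_def)
  qed
  have id: "(\<lambda>k. k) \<in> ring_hom (R\<lparr>carrier := K\<rparr>) R"
    using subfieldE(3)[OF K] by (intro ring_hom_memI) auto
  have "eval p x = \<zero> \<longleftrightarrow> eval (map (\<lambda>k. k) p) (\<zeta> \<otimes> x) = \<zero>" if "p \<in> carrier (K[X])" for p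
    using eval_transcendental[OF x(2) that] eval_transcendental[OF trans that] by auto
  from extend_hom_to_simple_extension[OF K id x(1) zx this] show thesis
    using that by blast
qed

section \<open>Monic polynomials\<close>

lemma coeff_map_uminus:
  "set p \<subseteq> carrier R \<Longrightarrow> coeff (map (\<lambda>a. \<ominus> a) p) i = \<ominus> (coeff p i)"
  by (induction p) auto

text \<open>
The leading terms cancel in \<open>p - q\<close>, so this difference has too small a degree to vanish on \<open>A\<close>
without being zero.
\<close>

lemma monic_poly_eqI:
  assumes p: "p \<in> carrier (poly_ring R)" "lead_coeff p = \<one>" and q: "q \<in> carrier (poly_ring R)" "lead_coeff q = \<one>"
    and len: "length p = length q" and A: "A \<subseteq> carrier R" "finite A" "degree p \<le> card A"
    and eq: "\<And>a. a \<in> A \<Longrightarrow> eval p a = eval q a"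
  shows "p = q"
proof (cases "p = []")
  case False
  interpret P: domain "poly_ring R"
    by (rule univ_poly_is_domain[OF carrier_is_subring])
  have q0: "q \<noteq> []"
    using False len by auto
  define r where "r = p \<ominus>\<^bsub>poly_ring R\<^esub> q"
  have r: "r \<in> carrier (poly_ring R)"
    using p q by (simp add: r_def)
  have sets: "set p \<subseteq> carrier R" "set q \<subseteq> carrier R"
    using p q polynomial_incl by (simp_all flip: univ_poly_carrier)
  have r_eq: "r = poly_add p (map (\<lambda>a. \<ominus> a) q)"
    using univ_poly_a_inv_def'[OF carrier_is_subring q(1)] by (simp add: r_def a_minus_def univ_poly_add del: poly_add.simps)
  have sets': "set (map (\<lambda>a. \<ominus> a) q) \<subseteq> carrier R"
    using sets by auto
  have "coeff r (degree p) = coeff p (degree p) \<ominus> coeff q (degree q)"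
    unfolding r_eq using poly_add_coeff[OF sets(1) sets'] coeff_map_uminus[OF sets(2)] len
    by (simp add: a_minus_def del: poly_add.simps)
  then have top: "coeff r (degree p) = \<zero>"
    unfolding lead_coeff_simp[OF False] lead_coeff_simp[OF q0] p(2) q(2) by simp
  have "length r \<le> length p"
    unfolding r_eq using poly_add_length_le[of p "map (\<lambda>a. \<ominus> a) q"] len by simp
  have "r = []"
  proof (rule ccontr)
    assume nz: "r \<noteq> []"
    have "lead_coeff r \<noteq> \<zero>"
      using r nz by (auto simp flip: univ_poly_carrier simp: polynomial_def)
    then have "degree r \<noteq> degree p"
      using top nz by (metis lead_coeff_simp)
    moreover have "degree r \<le> degree p"
      using \<open>length r \<le> length p\<close> by simp
    ultimately have "degree r < card A"
      using A(3) by simp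
    moreover have "A \<subseteq> {a. is_root r a}"
    proof
      fix a assume a: "a \<in> A"
      then have ac: "a \<in> carrier R"
        using A(1) by blast
      note ev = eval_is_hom[OF carrier_is_subring ac]
      interpret ev: ring_hom_ring "poly_ring R" R "\<lambda>p. eval p a"
        by (rule eval_ring_hom[OF carrier_is_subring ac])
      have "eval r a = eval p a \<ominus> eval q a"
        unfolding r_def a_minus_def using p(1) q(1) by simp
      then show "a \<in> {a. is_root r a}"
        using eq[OF a] ac nz ring_hom_closed[OF ev q(1)] by (simp add: is_root_def)
    qed
    ultimately show False
      using card_mono[OF finite_number_of_roots[OF r], of A] card_roots_le_degree[OF r] by linarith
  qed
  then have "p \<ominus>\<^bsub>poly_ring R\<^esub> q = \<zero>\<^bsub>poly_ring R\<^esub>"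
    by (simp add: r_def univ_poly_zero)
  then show ?thesis
    using p(1) q(1) by simp
qed (use len in auto)

lemma monic_mult:
  assumes p: "p \<in> carrier (poly_ring R)" "lead_coeff p = \<one>" "p \<noteq> []"
    and q: "q \<in> carrier (poly_ring R)" "lead_coeff q = \<one>" "q \<noteq> []"
  shows "p \<otimes>\<^bsub>poly_ring R\<^esub> q \<noteq> []" "lead_coeff (p \<otimes>\<^bsub>poly_ring R\<^esub> q) = \<one>"
    "degree (p \<otimes>\<^bsub>poly_ring R\<^esub> q) = degree p + degree q"
proof -
  interpret P: domain "poly_ring R"
    by (rule univ_poly_is_domain[OF carrier_is_subring])
  show "p \<otimes>\<^bsub>poly_ring R\<^esub> q \<noteq> []"
    using P.integral_iff[OF p(1) q(1)] p(3) q(3) by (simp add: univ_poly_zero)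
  show "lead_coeff (p \<otimes>\<^bsub>poly_ring R\<^esub> q) = \<one>"
    using poly_mult_lead_coeff[OF carrier_is_subring, of p q] p q
    by (simp add: univ_poly_carrier univ_poly_mult)
  show "degree (p \<otimes>\<^bsub>poly_ring R\<^esub> q) = degree p + degree q"
    using poly_mult_degree_eq[OF carrier_is_subring, of p q] p q
    by (simp add: univ_poly_carrier univ_poly_mult)
qed

lemma monic_poly_with_roots:
  assumes "finite A" "A \<subseteq> carrier R"
  obtains g where "g \<in> carrier (poly_ring R)" "g \<noteq> []" "lead_coeff g = \<one>" "degree g = card A"
    "\<And>a. a \<in> A \<Longrightarrow> eval g a = \<zero>"
proof -
  interpret P: domain "poly_ring R"
    by (rule univ_poly_is_domain[OF carrier_is_subring])
  have "\<exists>g \<in> carrier (poly_ring R). g \<noteq> [] \<and> lead_coeff g = \<one> \<and> degree g = card A \<and> (\<forall>a\<in>A. eval g a = \<zero>)"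
    using assms
  proof (induction A)
    case empty
    show ?case
      by (rule bexI[of _ "[\<one>]"]) (auto simp flip: univ_poly_carrier simp: const_is_polynomial)
  next
    case (insert b A)
    then obtain g where g: "g \<in> carrier (poly_ring R)" "g \<noteq> []" "lead_coeff g = \<one>" "degree g = card A"
      "\<And>a. a \<in> A \<Longrightarrow> eval g a = \<zero>"
      by auto
    have b: "b \<in> carrier R"
      using insert by simp
    define l where "l = [\<one>, \<ominus> b]"
    have l: "l \<in> carrier (poly_ring R)" "l \<noteq> []" "lead_coeff l = \<one>" "degree l = 1" "eval l b = \<zero>"
      using b by (auto simp flip: univ_poly_carrier simp: l_def polynomial_def r_neg)
    have "eval (l \<otimes>\<^bsub>poly_ring R\<^esub> g) a = \<zero>" if "a \<in> insert b A" for a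
    proof -
      have ac: "a \<in> carrier R"
        using that insert.prems by auto
      note ev = eval_is_hom[OF carrier_is_subring ac]
      have "eval l a = \<zero> \<or> eval g a = \<zero>"
        using that l(5) g(5) by auto
      then show ?thesis
        using ring_hom_mult[OF ev l(1) g(1)] ring_hom_closed[OF ev l(1)] ring_hom_closed[OF ev g(1)] by auto
    qed
    then show ?case
      using monic_mult[OF l(1,3,2) g(1,3,2)] l(1,4) g(1,4) insert.hyps
      by (intro bexI[of _ "l \<otimes>\<^bsub>poly_ring R\<^esub> g"]) auto
  qed
  then show thesis
    using that by blast
qed

lemma eval_pow:
  assumes "p \<in> carrier (poly_ring R)" "a \<in> carrier R"
  shows "eval (p [^]\<^bsub>poly_ring R\<^esub> (n::nat)) a = eval p a [^] n"
proof -
  interpret P: domain "poly_ring R"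
    by (rule univ_poly_is_domain[OF carrier_is_subring])
  note ev = eval_is_hom[OF carrier_is_subring assms(2)]
  show ?thesis
  proof (induction n)
    case 0
    show ?case
      using ring_hom_one[OF ev] by simp
  next
    case (Suc n)
    then show ?case
      using ring_hom_mult[OF ev P.nat_pow_closed[OF assms(1)] assms(1)] by simp
  qed
qed

lemma monic_pow:
  assumes p: "p \<in> carrier (poly_ring R)" "lead_coeff p = \<one>" "p \<noteq> []"
  shows "p [^]\<^bsub>poly_ring R\<^esub> (n::nat) \<noteq> []" "lead_coeff (p [^]\<^bsub>poly_ring R\<^esub> n) = \<one>"
    "degree (p [^]\<^bsub>poly_ring R\<^esub> n) = n * degree p"
proof -
  interpret P: domain "poly_ring R"
    by (rule univ_poly_is_domain[OF carrier_is_subring])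
  have "p [^]\<^bsub>poly_ring R\<^esub> n \<noteq> [] \<and> lead_coeff (p [^]\<^bsub>poly_ring R\<^esub> n) = \<one>"
  proof (induction n)
    case 0
    show ?case
      by (simp add: univ_poly_one)
  next
    case (Suc n)
    then show ?case
      using monic_mult(1,2)[OF P.nat_pow_closed[OF p(1)] _ _ p] by simp
  qed
  then show "p [^]\<^bsub>poly_ring R\<^esub> n \<noteq> []" "lead_coeff (p [^]\<^bsub>poly_ring R\<^esub> n) = \<one>"
    by auto
  show "degree (p [^]\<^bsub>poly_ring R\<^esub> n) = n * degree p"
    using polynomial_pow_degree[OF p(1)] .
qed

lemma monic_add_lower:
  assumes p: "p \<in> carrier (poly_ring R)" "lead_coeff p = \<one>" and q: "q \<in> carrier (poly_ring R)"
    and deg: "degree q < degree p"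
  shows "p \<oplus>\<^bsub>poly_ring R\<^esub> q \<noteq> []" "lead_coeff (p \<oplus>\<^bsub>poly_ring R\<^esub> q) = \<one>"
    "degree (p \<oplus>\<^bsub>poly_ring R\<^esub> q) = degree p"
proof -
  have sets: "set p \<subseteq> carrier R" "set q \<subseteq> carrier R"
    using p q polynomial_incl by (simp_all flip: univ_poly_carrier)
  have p0: "p \<noteq> []"
    using deg by auto
  show deg': "degree (p \<oplus>\<^bsub>poly_ring R\<^esub> q) = degree p"
    using poly_add_degree_eq[of "carrier R" p q] carrier_is_subring p q deg
    by (simp add: univ_poly_add univ_poly_carrier del: poly_add.simps)
  then show nz: "p \<oplus>\<^bsub>poly_ring R\<^esub> q \<noteq> []"
    using deg by auto
  have "lead_coeff (p \<oplus>\<^bsub>poly_ring R\<^esub> q) = coeff (poly_add p q) (degree p)"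
    using lead_coeff_simp[OF nz] deg' by (simp add: univ_poly_add del: poly_add.simps)
  also have "\<dots> = coeff p (degree p) \<oplus> coeff q (degree p)"
    using poly_add_coeff[OF sets] by simp
  also have "\<dots> = \<one>"
    unfolding lead_coeff_simp[OF p0] p(2) coeff_degree[OF deg] by simp
  finally show "lead_coeff (p \<oplus>\<^bsub>poly_ring R\<^esub> q) = \<one>" .
qed

lemma var_monic: "X \<in> carrier (poly_ring R)" "lead_coeff X = \<one>" "X \<noteq> []" "degree X = 1"
  using var_closed(1)[OF carrier_is_subring] by (auto simp: var_def)

lemma const_poly:
  assumes "a \<in> carrier R"
  shows "poly_of_const a \<in> carrier (poly_ring R)" "degree (poly_of_const a) = 0"
    "b \<in> carrier R \<Longrightarrow> eval (poly_of_const a) b = a"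
  using ring_hom_closed[OF canonical_embedding_is_hom[OF carrier_is_subring], of a] assms
  by (auto simp: poly_of_const_def)

lemma eval_add:
  assumes "p \<in> carrier (poly_ring R)" "q \<in> carrier (poly_ring R)" "a \<in> carrier R"
  shows "eval (p \<oplus>\<^bsub>poly_ring R\<^esub> q) a = eval p a \<oplus> eval q a"
  using ring_hom_add[OF eval_is_hom[OF carrier_is_subring assms(3)] assms(1,2)] .

lemma eval_mult:
  assumes "p \<in> carrier (poly_ring R)" "q \<in> carrier (poly_ring R)" "a \<in> carrier R"
  shows "eval (p \<otimes>\<^bsub>poly_ring R\<^esub> q) a = eval p a \<otimes> eval q a"
  using ring_hom_mult[OF eval_is_hom[OF carrier_is_subring assms(3)] assms(1,2)] .

section \<open>Fields generated by roots of separable split polynomials are Galois\<close>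

text \<open>
Write \<open>a\<close> as a value \<open>r(s)\<close> with \<open>r\<close> of smaller degree than the minimal polynomial \<open>f\<close> of \<open>s\<close>. For every root \<open>b\<close>
of \<open>f\<close> there is an embedding sending \<open>s\<close> to \<open>b\<close>, and since it fixes \<open>a\<close>, also \<open>a = r(b)\<close>. So \<open>r - a\<close> has at
least as many roots as the degree of \<open>f\<close>, which forces \<open>r\<close> to be constant.
\<close>

lemma fixed_imp_mem_base:
  assumes H: "subfield H R" and E: "subfield E R" "H \<subseteq> E"
    and s: "sep_split_over H s" and a: "a \<in> generate_field R (insert s E)"
    and fixed: "\<And>\<psi>. \<lbrakk>\<psi> \<in> ring_hom (R\<lparr>carrier := generate_field R (insert s E)\<rparr>) R;
      \<And>e. e \<in> E \<Longrightarrow> \<psi> e = e\<rbrakk> \<Longrightarrow> \<psi> a = a"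
  shows "a \<in> E"
proof -
  note sub = subfieldE(1)[OF E(1)]
  define G where "G = generate_field R (insert s E)"
  define f where "f = Irr E s"
  have alg: "(algebraic over E) s" and s': "s \<in> carrier R"
    using sep_split_over_algebraic[OF s E(2)] s by (auto simp: sep_split_over_def)
  have sE: "insert s E \<subseteq> carrier R"
    using s' subfieldE(3)[OF E(1)] by simp
  have G: "subfield G R" "insert s E \<subseteq> G"
    using generate_fieldE(1,2)[OF sE G_def] .
  have f: "f \<in> carrier (E[X])" "eval f s = \<zero>" "degree f \<ge> 1" "f \<noteq> []"
    using IrrE(1,4)[OF E(1) s' alg] degree_Irr_pos[OF E(1) s' alg] by (auto simp: f_def)
  have id: "(\<lambda>x. x) \<in> ring_hom (R\<lparr>carrier := E\<rparr>) R"
    using subfieldE(3)[OF E(1)] by (intro ring_hom_memI) auto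
  have split: "sep_split f"
    using sep_split_map_Irr[OF H E id _ s] by (simp add: f_def)
  have "subfield (simple_extension E s) R"
    using simple_extension_is_subfield[OF E(1) s'] alg by simp
  then have "a \<in> simple_extension E s"
    using a generate_field_min_subfield1[OF sE, of "simple_extension E s"]
      simple_extension_incl[OF subfieldE(3)[OF E(1)] s'] simple_extension_mem[OF sub s'] by blast
  then obtain p where p: "p \<in> carrier (E[X])" "a = eval p s"
    unfolding simple_extension_as_eval_img[OF subfieldE(3)[OF E(1)] s'] by blast
  define r where "r = p pmod f"
  have r: "r \<in> carrier (E[X])" and q: "p pdiv f \<in> carrier (E[X])"
    using long_division_closed[OF E(1) p(1) f(1)] by (simp_all add: r_def)
  have deg_r: "r = [] \<or> degree r < degree f"
    using pmod_degree[OF E(1) p(1) f(1,4)] by (simp add: r_def)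
  interpret UP: domain "E[X]"
    by (rule univ_poly_is_domain[OF sub])
  note ev = eval_is_hom[OF sub s']
  have rs_c: "eval r s \<in> carrier R" "eval (p pdiv f) s \<in> carrier R"
    using ring_hom_closed[OF ev] r q by blast+
  have "a = eval (f \<otimes>\<^bsub>E[X]\<^esub> (p pdiv f) \<oplus>\<^bsub>E[X]\<^esub> r) s"
    using pdiv_pmod[OF E(1) p(1) f(1)] p(2) by (simp add: r_def)
  also have "\<dots> = eval r s"
    using ring_hom_add[OF ev UP.m_closed[OF f(1) q] r] ring_hom_mult[OF ev f(1) q] f(2) rs_c by simp
  finally have a_eq: "a = eval r s" .
  have ac: "a \<in> carrier R"
    using a_eq rs_c by simp
  have set_r: "set r \<subseteq> E"
    using r polynomial_incl by (simp flip: univ_poly_carrier)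
  have root: "eval r b = a" if b: "b \<in> carrier R" "eval f b = \<zero>" for b
  proof -
    obtain \<psi> where \<psi>: "\<psi> \<in> ring_hom (R\<lparr>carrier := G\<rparr>) R" "\<psi> s = b" "\<And>e. e \<in> E \<Longrightarrow> \<psi> e = e"
      using extend_hom_to_root[OF E(1) id s' alg b(1)] b(2) unfolding G_def f_def by auto
    interpret \<psi>: ring_hom_ring "R\<lparr>carrier := G\<rparr>" R \<psi>
      using subring_is_ring[OF subfieldE(1)[OF G(1)]] ring_axioms \<psi>(1) by (rule ring_hom_ringI2)
    have "\<psi> (eval r s) = eval (map \<psi> r) b"
      using \<psi>.eval_hom'[of s r] set_r G(2) \<psi>(2) by (auto simp: eval_consistent[OF subfieldE(1)[OF G(1)]])
    moreover have "map \<psi> r = r"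
      using \<psi>(3) set_r by (intro map_idI) blast
    moreover have "\<psi> a = a"
      using fixed[folded G_def] \<psi>(1,3) by blast
    ultimately show ?thesis
      using a_eq by simp
  qed
  have "degree r = 0"
  proof (rule ccontr)
    assume deg: "degree r \<noteq> 0"
    define c where "c = poly_of_const (\<ominus> a)"
    interpret P: domain "poly_ring R"
      by (rule univ_poly_is_domain[OF carrier_is_subring])
    have c: "c \<in> carrier (poly_ring R)" "degree c = 0"
      using ring_hom_closed[OF canonical_embedding_is_hom[OF carrier_is_subring], of "\<ominus> a"] ac
      by (simp_all add: c_def poly_of_const_def)
    have eval_c: "eval c b = \<ominus> a" if "b \<in> carrier R" for b
      using ac that by (simp add: c_def poly_of_const_def)
    have rR: "r \<in> carrier (poly_ring R)"
      using carrier_polynomial_shell[OF sub r] .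
    define d where "d = r \<oplus>\<^bsub>poly_ring R\<^esub> c"
    have d: "d \<in> carrier (poly_ring R)"
      using rR c(1) by (simp add: d_def)
    have deg_d: "degree d = degree r"
      using poly_add_degree_eq[of "carrier R" r c] carrier_is_subring rR c deg
      by (simp add: d_def univ_poly_add univ_poly_carrier del: poly_add.simps)
    have "{b. is_root f b} \<subseteq> {b. is_root d b}"
    proof
      fix b assume "b \<in> {b. is_root f b}"
      then have b: "b \<in> carrier R" "eval f b = \<zero>"
        by (auto simp: is_root_def)
      have "eval d b = eval r b \<oplus> eval c b"
        unfolding d_def using ring_hom_add[OF eval_is_hom[OF carrier_is_subring b(1)] rR c(1)] .
      then have "eval d b = \<zero>"
        using root[OF b] eval_c[OF b(1)] ac by (simp add: r_neg)
      then show "b \<in> {b. is_root d b}"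
        using b(1) deg_d deg by (auto simp: is_root_def)
    qed
    then have "degree f \<le> degree d"
      using card_mono[OF finite_number_of_roots[OF d]] card_roots_le_degree[OF d]
        sep_split_card_roots[OF split] by (metis le_trans)
    then show False
      using deg_d deg_r deg by auto
  qed
  show "a \<in> E"
  proof (cases r)
    case Nil
    then show ?thesis
      using a_eq subringE(2)[OF sub] by simp
  next
    case (Cons e r')
    then have "r = [e]" "e \<in> E"
      using \<open>degree r = 0\<close> set_r by auto
    moreover have "e \<in> carrier R"
      using \<open>e \<in> E\<close> sE by blast
    ultimately show ?thesis
      using a_eq by simp
  qed
qed

text \<open>
Descend along the chain of fields obtained by adjoining the elements of \<open>S\<close> one at a time. An
embedding of a step of the chain extends to the whole field, so it fixes \<open>a\<close>, and the preceding
lemma removes the last adjoined element.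
\<close>

lemma fixed_by_all_homs_imp_mem:
  assumes H: "subfield H R" and S: "finite S" "\<And>s. s \<in> S \<Longrightarrow> sep_split_over H s"
    and gen: "generate_field R (H \<union> S) = carrier R" and a: "a \<in> carrier R"
    and fixed: "\<And>\<psi>. \<lbrakk>\<psi> \<in> ring_hom R R; \<And>h. h \<in> H \<Longrightarrow> \<psi> h = h\<rbrakk> \<Longrightarrow> \<psi> a = a"
  shows "a \<in> H"
proof -
  have "a \<in> H" if "finite T" "T \<subseteq> S" "a \<in> generate_field R (H \<union> T)" for T
    using that
  proof (induction T)
    case empty
    then show ?case
      by (simp add: generate_field_of_subfield[OF H])
  next
    case (insert s T)
    have HS: "H \<union> S \<subseteq> carrier R"
      using S(2) subfieldE(3)[OF H] by (auto simp: sep_split_over_def)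
    then have HT: "H \<union> T \<subseteq> carrier R" "{s} \<subseteq> carrier R" "insert s (H \<union> T) \<subseteq> carrier R"
      using insert.prems(1) by auto
    define E where "E = generate_field R (H \<union> T)"
    have E: "subfield E R" "H \<subseteq> E"
      using generate_fieldE(1,2)[OF HT(1) E_def] by auto
    have G_eq: "generate_field R (insert s E) = generate_field R (insert s (H \<union> T))"
      using generate_field_generate_field_Un[OF HT(1,2)] by (simp add: E_def)
    define G where "G = generate_field R (insert s E)"
    have G: "subfield G R" "insert s (H \<union> T) \<subseteq> G"
      using generate_fieldE(1,2)[OF HT(3) refl] unfolding G_def G_eq by auto
    have GS: "generate_field R (G \<union> S) = carrier R"
    proof
      have sub: "G \<union> S \<subseteq> carrier R"
        using subfieldE(3)[OF G(1)] HS by blast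
      show "generate_field R (G \<union> S) \<subseteq> carrier R"
        using generate_field_incl[OF sub] .
      show "carrier R \<subseteq> generate_field R (G \<union> S)"
        unfolding gen[symmetric] using G(2) by (intro mono_generate_field sub) blast
    qed
    have "a \<in> E"
    proof (rule fixed_imp_mem_base[OF H E])
      show "sep_split_over H s"
        using insert.prems(1) S(2) by blast
      show "a \<in> generate_field R (insert s E)"
        using insert.prems(2) unfolding G_eq by simp
      fix \<psi> assume \<psi>: "\<psi> \<in> ring_hom (R\<lparr>carrier := generate_field R (insert s E)\<rparr>) R"
        "\<And>e. e \<in> E \<Longrightarrow> \<psi> e = e"
      have "H \<subseteq> G" "\<And>h. h \<in> H \<Longrightarrow> \<psi> h = h"
        using G(2) E(2) \<psi>(2) by auto
      from extend_hom_to_generated[OF H G(1) this(1) \<psi>(1)[folded G_def] this(2) S]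
      obtain \<chi> where \<chi>: "\<chi> \<in> ring_hom (R\<lparr>carrier := generate_field R (G \<union> S)\<rparr>) R"
        "\<And>e. e \<in> G \<Longrightarrow> \<chi> e = \<psi> e"
        by blast
      have "\<chi> \<in> ring_hom R R"
        using \<chi>(1) by (simp add: GS)
      moreover have "\<chi> h = h" if "h \<in> H" for h
        using that \<chi>(2)[of h] \<psi>(2)[of h] \<open>H \<subseteq> G\<close> E(2) by (metis subsetD)
      moreover have "a \<in> G"
        using insert.prems(2) unfolding G_def G_eq by simp
      ultimately show "\<psi> a = a"
        using fixed[of \<chi>] \<chi>(2) by metis
    qed
    then show ?case
      using insert by (auto simp: E_def)
  qed
  from this[OF S(1) order_refl] show ?thesis
    using a gen by simp
qed

text \<open>
The orbit \<open>A\<close> of \<open>a\<close> under the set \<open>\<Gamma>\<close> of embeddings over \<open>H\<close> is finite because it consists of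
roots of the minimal polynomial of \<open>a\<close>, and every member of \<open>\<Gamma>\<close> permutes it. The monic polynomial \<open>g\<close> with
roots \<open>A\<close> is therefore fixed by \<open>\<Gamma>\<close>, so its coefficients are in \<open>H\<close>. It has simple roots and is divisible by
the minimal polynomial of \<open>a\<close>.
\<close>

theorem galois_extension_generated:
  assumes H: "subfield H R" and S: "finite S" "\<And>s. s \<in> S \<Longrightarrow> sep_split_over H s"
    and gen: "generate_field R (H \<union> S) = carrier R"
  shows "galois_extension R H"
proof -
  have alg: "(algebraic over H) a" if "a \<in> carrier R" for a
  proof -
    have "H \<union> S \<subseteq> {a \<in> carrier R. (algebraic over H) a}"
      using S(2) sep_split_over_algebraic[of H _ H] algebraic_self[OF subfieldE(1)[OF H]] subfieldE(3)[OF H]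
      by (auto simp: sep_split_over_def)
    then have "generate_field R (H \<union> S) \<subseteq> {a \<in> carrier R. (algebraic over H) a}"
      by (intro generate_field_min_subfield1 subfield_of_algebraics H) auto
    then show ?thesis
      using that gen by blast
  qed
  have main: "sep_split (Irr H a)" if a: "a \<in> carrier R" for a
  proof -
    define f where "f = Irr H a"
    have f: "f \<in> carrier (H[X])" "eval f a = \<zero>" "f \<in> carrier (poly_ring R)" "f \<noteq> []"
      using IrrE[OF H a alg[OF a]] carrier_polynomial_shell[OF subfieldE(1)[OF H]]
        degree_Irr_pos[OF H a alg[OF a]] by (auto simp: f_def)
    define \<Gamma> where "\<Gamma> = {\<psi> \<in> ring_hom R R. \<forall>h\<in>H. \<psi> h = h}"
    define A where "A = (\<lambda>\<psi>. \<psi> a) ` \<Gamma>"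
    have hom: "ring_hom_ring R R \<psi>" if "\<psi> \<in> \<Gamma>" for \<psi>
      using that ring_axioms by (intro ring_hom_ringI2) (auto simp: \<Gamma>_def)
    have eval_fixed: "\<psi> (eval g b) = eval (map \<psi> g) (\<psi> b)"
      if "\<psi> \<in> \<Gamma>" "g \<in> carrier (poly_ring R)" "b \<in> carrier R" for \<psi> g b
      using ring_hom_ring.eval_hom[OF hom[OF that(1)] carrier_is_subring that(3,2)] .
    have A_sub: "A \<subseteq> {b. is_root f b}"
    proof
      fix b assume "b \<in> A"
      then obtain \<psi> where \<psi>: "\<psi> \<in> \<Gamma>" "b = \<psi> a"
        by (auto simp: A_def)
      have "set f \<subseteq> H"
        using f(1) polynomial_incl by (simp flip: univ_poly_carrier)
      then have "map \<psi> f = f"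
        using \<psi>(1) by (intro map_idI) (auto simp: \<Gamma>_def)
      moreover have "\<psi> \<zero> = \<zero>"
        using \<psi>(1) ring_hom_zero[of \<psi> R R] ring_axioms by (auto simp: \<Gamma>_def)
      moreover have "\<psi> a \<in> carrier R"
        using \<psi>(1) a ring_hom_closed by (auto simp: \<Gamma>_def)
      ultimately show "b \<in> {b. is_root f b}"
        using eval_fixed[OF \<psi>(1) f(3) a] f(2,4) \<psi>(2) by (simp add: is_root_def)
    qed
    then have A: "finite A" "A \<subseteq> carrier R"
      using finite_subset[OF A_sub finite_number_of_roots[OF f(3)]] by (auto simp: is_root_def)
    have "(\<lambda>x. x) \<in> \<Gamma>"
      by (auto simp: \<Gamma>_def intro!: ring_hom_memI)
    then have a_A: "a \<in> A"
      by (force simp: A_def)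
    have perm: "\<psi> ` A = A" if \<psi>: "\<psi> \<in> \<Gamma>" for \<psi>
    proof (rule endo_inj_surj[OF A(1)])
      show "\<psi> ` A \<subseteq> A"
      proof
        fix b assume "b \<in> \<psi> ` A"
        then obtain \<chi> where \<chi>: "\<chi> \<in> \<Gamma>" "b = \<psi> (\<chi> a)"
          by (auto simp: A_def)
        have "\<psi> \<circ> \<chi> \<in> \<Gamma>"
          using \<psi> \<chi>(1) ring_hom_trans by (auto simp: \<Gamma>_def)
        then show "b \<in> A"
          using \<chi>(2) unfolding A_def by (intro image_eqI[of _ _ "\<psi> \<circ> \<chi>"]) auto
      qed
      have "inj_on \<psi> (carrier R)"
        using \<psi> non_trivial_field_hom_is_inj[OF _ field_axioms field_axioms] by (auto simp: \<Gamma>_def)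
      then show "inj_on \<psi> A"
        using A(2) inj_on_subset by blast
    qed
    obtain g where g: "g \<in> carrier (poly_ring R)" "g \<noteq> []" "lead_coeff g = \<one>" "degree g = card A"
      "\<And>b. b \<in> A \<Longrightarrow> eval g b = \<zero>"
      using monic_poly_with_roots[OF A] by blast
    have g_fixed: "map \<psi> g = g" if \<psi>: "\<psi> \<in> \<Gamma>" for \<psi>
    proof (rule monic_poly_eqI[OF _ _ g(1,3) _ A(2,1)])
      show "map \<psi> g \<in> carrier (poly_ring R)"
        using \<psi> polynomial_hom[OF _ field_axioms field_axioms g(1)] by (simp add: \<Gamma>_def)
      show "lead_coeff (map \<psi> g) = \<one>"
        using g(2,3) \<psi> ring_hom_one by (auto simp: hd_map \<Gamma>_def)
      show "degree (map \<psi> g) \<le> card A"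
        using g(4) by simp
      fix b assume "b \<in> A"
      then obtain c where c: "c \<in> A" "b = \<psi> c"
        using perm[OF \<psi>] by blast
      have "\<psi> \<zero> = \<zero>"
        using \<psi> ring_hom_zero[of \<psi> R R] ring_axioms by (auto simp: \<Gamma>_def)
      then show "eval (map \<psi> g) b = eval g b"
        using eval_fixed[OF \<psi> g(1), of c] g(5) \<open>b \<in> A\<close> c A(2) by auto
    qed simp
    have "set g \<subseteq> carrier R"
      using g(1) polynomial_incl by (simp flip: univ_poly_carrier)
    moreover have "\<psi> c = c" if "c \<in> set g" "\<psi> \<in> \<Gamma>" for c \<psi>
      using g_fixed[OF that(2)] that(1) by (metis map_eq_conv map_ident)
    ultimately have "set g \<subseteq> H"
      using fixed_by_all_homs_imp_mem[OF H S gen] by (auto simp: \<Gamma>_def subset_iff)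
    then have gH: "g \<in> carrier (H[X])"
      using g(1) by (auto simp: polynomial_def simp flip: univ_poly_carrier)
    have "sep_split g"
    proof (rule sep_splitI[OF g(1,2)])
      have "A \<subseteq> {b. is_root g b}"
        using g(2,5) A(2) by (auto simp: is_root_def)
      then show "degree g \<le> card {b. is_root g b}"
        unfolding g(4) by (rule card_mono[OF finite_number_of_roots[OF g(1)]])
    qed
    then show ?thesis
      using sep_split_divisor f(3) Irr_minimal[OF H a alg[OF a] gH g(5)[OF a_A]] by (simp add: f_def)
  qed
  show ?thesis
  proof (intro galois_extension.intro normal_extension.intro algebraic_extension.intro
      galois_extension_axioms.intro normal_extension_axioms.intro algebraic_extension_axioms.intro)
  qed (use field_axioms H alg main in \<open>auto simp: sep_split_def\<close>)
qed

text \<open>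
A normal extension \<open>E\<close> contains the conjugates of its elements that lie in a larger field: \<open>f\<close> already has as
many distinct roots in \<open>E\<close> as its degree permits.
\<close>

lemma root_mem_of_split:
  assumes E: "subfield E R" and f: "f \<in> carrier (E[X])" "f \<noteq> []" "ring.splitted (R\<lparr>carrier := E\<rparr>) f"
    "\<And>b. b \<in> E \<Longrightarrow> ring.alg_mult (R\<lparr>carrier := E\<rparr>) f b \<le> 1"
    and r: "r \<in> carrier R" "eval f r = \<zero>"
  shows "r \<in> E"
proof -
  note sub = subfieldE(1)[OF E]
  interpret E: field "R\<lparr>carrier := E\<rparr>"
    using subfield_iff(2)[OF E] .
  have poly: "poly_ring (R\<lparr>carrier := E\<rparr>) = E[X]"
    by (simp add: univ_poly_consistent[OF sub])
  have "E.alg_mult f b \<le> 1" for b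
    using f(4)[of b] by (cases "b \<in> E") (auto simp: E.alg_mult_def)
  then have "E.sep_split f"
    using f(1-3) unfolding E.sep_split_def poly by simp
  then have "card {a. E.is_root f a} = degree f"
    by (rule E.sep_split_card_roots)
  moreover have fR: "f \<in> carrier (poly_ring R)"
    using carrier_polynomial_shell[OF sub f(1)] .
  moreover have root: "E.is_root f a \<longleftrightarrow> a \<in> E \<and> is_root f a" for a
    using subfieldE(3)[OF E] by (auto simp: E.is_root_def is_root_def eval_consistent[OF sub])
  ultimately have "{a. E.is_root f a} = {a. is_root f a}"
    using card_seteq[OF finite_number_of_roots[OF fR], of "{a. E.is_root f a}"] card_roots_le_degree[OF fR] by auto
  moreover have "is_root f r"
    using r f(2) by (simp add: is_root_def)
  ultimately show ?thesis
    using root by blast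
qed

section \<open>Finite subfields and the Frobenius map\<close>

lemma finite_subfield_card_gt_1:
  assumes "subfield F R" "finite F" shows "card F > 1"
proof -
  have "{\<zero>, \<one>} \<subseteq> F"
    using subringE(2,3)[OF subfieldE(1)[OF assms(1)]] by simp
  then show ?thesis
    using card_mono[OF assms(2), of "{\<zero>, \<one>}"] by simp
qed

lemma finite_subfield_pow_card:
  assumes F: "subfield F R" "finite F" and a: "a \<in> F"
  shows "a [^] (card F - 1) = (if a = \<zero> then \<zero> else \<one>)" "a [^] card F = a"
proof -
  interpret F: field "R\<lparr>carrier := F\<rparr>"
    using subfield_iff(2)[OF F(1)] .
  have card: "card F > 1"
    by (rule finite_subfield_card_gt_1[OF F])
  have aR: "a \<in> carrier R"
    using a subfieldE(3)[OF F(1)] by blast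
  have "a [^] (card F - 1) = \<one>" if "a \<noteq> \<zero>"
  proof -
    interpret M: group "Multiplicative_Group.mult_of (R\<lparr>carrier := F\<rparr>)"
      by (rule F.field_mult_group)
    have "a [^]\<^bsub>Multiplicative_Group.mult_of (R\<lparr>carrier := F\<rparr>)\<^esub> order (Multiplicative_Group.mult_of (R\<lparr>carrier := F\<rparr>)) = \<one>"
      using M.pow_order_eq_1[of a] that a by simp
    moreover have "order (Multiplicative_Group.mult_of (R\<lparr>carrier := F\<rparr>)) = card F - 1"
      using F.order_mult_of F(2) by (simp add: order_def)
    ultimately show ?thesis
      by (simp add: nat_pow_def Multiplicative_Group.mult_mult_of Multiplicative_Group.one_mult_of)
  qed
  then show 1: "a [^] (card F - 1) = (if a = \<zero> then \<zero> else \<one>)"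
    using card nat_pow_zero[of "card F - 1"] by auto
  have "a [^] card F = a [^] (card F - 1) \<otimes> a"
    using card nat_pow_Suc[of a "card F - 1"] by simp
  then show "a [^] card F = a"
    using 1 aR by auto
qed

text \<open>
Let \<open>q = card F\<close>. As polynomials in \<open>X\<close>, \<open>(X + b)^q\<close> and \<open>X^q + b^q\<close> are monic of degree \<open>q\<close>, hence equal once
they agree on the \<open>q\<close> elements of \<open>F\<close>. For \<open>b\<close> in \<open>F\<close> they do, since the \<open>q\<close>-th power is the identity
there. This gives additivity for one summand in \<open>F\<close>, which is in turn the agreement on \<open>F\<close> required for
arbitrary \<open>b\<close>.
\<close>

lemma frobenius_add:
  assumes F: "subfield F R" "finite F" and a: "a \<in> carrier R" and b: "b \<in> carrier R"
  shows "(a \<oplus> b) [^] card F = a [^] card F \<oplus> b [^] card F"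
proof -
  define q where "q = card F"
  have q: "q \<ge> 1"
    using finite_subfield_card_gt_1[OF F] by (simp add: q_def)
  have FR: "F \<subseteq> carrier R"
    using subfieldE(3)[OF F(1)] .
  interpret P: domain "poly_ring R"
    by (rule univ_poly_is_domain[OF carrier_is_subring])
  have extend: "(a \<oplus> b) [^] q = a [^] q \<oplus> b [^] q"
    if b: "b \<in> carrier R" and F_b: "\<And>a. a \<in> F \<Longrightarrow> (a \<oplus> b) [^] q = a [^] q \<oplus> b [^] q"
      and a: "a \<in> carrier R" for a b
  proof -
    define l where "l = X \<oplus>\<^bsub>poly_ring R\<^esub> poly_of_const b"
    have l: "l \<in> carrier (poly_ring R)" "lead_coeff l = \<one>" "l \<noteq> []" "degree l = 1"
      using monic_add_lower[OF var_monic(1,2) const_poly(1)[OF b]] const_poly(2)[OF b] var_monic(4)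
        P.a_closed[OF var_monic(1) const_poly(1)[OF b]] by (auto simp: l_def)
    define A where "A = l [^]\<^bsub>poly_ring R\<^esub> q"
    define B where "B = X [^]\<^bsub>poly_ring R\<^esub> q \<oplus>\<^bsub>poly_ring R\<^esub> poly_of_const (b [^] q)"
    have bq: "b [^] q \<in> carrier R"
      using b by simp
    have Xq: "X [^]\<^bsub>poly_ring R\<^esub> q \<in> carrier (poly_ring R)"
      using var_monic(1) by simp
    have A: "A \<in> carrier (poly_ring R)" "lead_coeff A = \<one>" "A \<noteq> []" "degree A = q"
      using monic_pow[OF l(1,2,3), of q] l(1,4) by (auto simp: A_def)
    have "degree (poly_of_const (b [^] q)) < degree (X [^]\<^bsub>poly_ring R\<^esub> q)"
      using q const_poly(2)[OF bq] monic_pow(3)[OF var_monic(1-3), of q] var_monic(4) by simp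
    from monic_add_lower[OF Xq monic_pow(2)[OF var_monic(1-3)] const_poly(1)[OF bq] this]
    have B: "B \<in> carrier (poly_ring R)" "lead_coeff B = \<one>" "B \<noteq> []" "degree B = q"
      using monic_pow(3)[OF var_monic(1-3), of q] var_monic(4) Xq const_poly(1)[OF bq]
      by (auto simp: B_def)
    have eval_A: "eval A c = (c \<oplus> b) [^] q" if "c \<in> carrier R" for c
      using that l(1) eval_add[OF var_monic(1) const_poly(1)[OF b] that]
      by (simp add: A_def eval_pow l_def eval_var const_poly(3)[OF b])
    have eval_B: "eval B c = c [^] q \<oplus> b [^] q" if "c \<in> carrier R" for c
      using that eval_add[OF Xq const_poly(1)[OF bq] that]
      by (simp add: B_def eval_pow var_monic(1) eval_var const_poly(3)[OF bq])
    have "length A = length B"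
      using A(3,4) B(3,4) by (cases A; cases B; simp)
    then have "A = B"
    proof (rule monic_poly_eqI[OF A(1,2) B(1,2) _ FR F(2)])
      show "degree A \<le> card F"
        using A(4) by (simp add: q_def)
      show "eval A c = eval B c" if "c \<in> F" for c
        using that F_b FR by (auto simp: eval_A eval_B)
    qed
    then show ?thesis
      using eval_A[OF a] eval_B[OF a] by simp
  qed
  have F_add: "(a \<oplus> b) [^] q = a [^] q \<oplus> b [^] q" if "a \<in> carrier R" "b \<in> F" for a b
  proof (rule extend)
    show "(c \<oplus> b) [^] q = c [^] q \<oplus> b [^] q" if "c \<in> F" for c
      using that \<open>b \<in> F\<close> finite_subfield_pow_card(2)[OF F] subringE(7)[OF subfieldE(1)[OF F(1)]]
      by (simp add: q_def)
  qed (use that FR in auto)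
  show ?thesis
    unfolding q_def[symmetric]
  proof (rule extend[OF b _ a])
    show "(c \<oplus> b) [^] q = c [^] q \<oplus> b [^] q" if "c \<in> F" for c
      using F_add[OF b that] that FR b by (simp add: a_comm subset_iff)
  qed
qed

text \<open>
The additive order of \<open>1\<close> divides \<open>card F\<close>. If it also divided \<open>n\<close>, it would be \<open>1\<close>.
\<close>

lemma finite_subfield_add_pow_nonzero:
  fixes n :: nat
  assumes F: "subfield F R" "finite F" and n: "coprime n (card F)"
  shows "[n] \<cdot> \<one> \<noteq> \<zero>"
proof
  assume n0: "[n] \<cdot> \<one> = \<zero>"
  interpret F: field "R\<lparr>carrier := F\<rparr>"
    using subfield_iff(2)[OF F(1)] .
  (* d is the characteristic of the field. *)
  define d where "d = group.ord (add_monoid (R\<lparr>carrier := F\<rparr>)) \<one>"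
  have one: "\<one> \<in> carrier (add_monoid (R\<lparr>carrier := F\<rparr>))"
    using F.one_closed by simp
  have pow: "[k] \<cdot> \<one> = \<one> [^]\<^bsub>add_monoid (R\<lparr>carrier := F\<rparr>)\<^esub> k" for k :: nat
    by (simp add: add_pow_def nat_pow_def)
  have "\<one> [^]\<^bsub>add_monoid (R\<lparr>carrier := F\<rparr>)\<^esub> n = \<one>\<^bsub>add_monoid (R\<lparr>carrier := F\<rparr>)\<^esub>"
    using n0 unfolding pow by simp
  then have "d dvd n"
    using group.pow_eq_id[OF F.a_group one] by (simp add: d_def)
  moreover have "d dvd card F"
    using group.ord_dvd_group_order[OF F.a_group one] by (simp add: order_def d_def)
  ultimately have "d = 1"
    using n coprime_common_divisor_nat by blast
  then show False
    using group.ord_eq_1[OF F.a_group one] by (simp add: d_def)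
qed

section \<open>Kummer and Artin-Schreier elements\<close>

text \<open>
The polynomial \<open>p - p(s)\<close> vanishes on \<open>A\<close> and at \<open>s\<close>.
\<close>

lemma sep_split_overI:
  assumes H: "subfield H R" and p: "p \<in> carrier (H[X])" "lead_coeff p = \<one>" "degree p \<ge> 1"
    and s: "s \<in> carrier R" and c: "eval p s \<in> H"
    and A: "A \<subseteq> carrier R" "finite A" "degree p \<le> card A" "\<And>a. a \<in> A \<Longrightarrow> eval p a = eval p s"
  shows "sep_split_over H s"
proof -
  note sub = subfieldE(1)[OF H]
  have pR: "p \<in> carrier (poly_ring R)"
    using carrier_polynomial_shell[OF sub p(1)] .
  define c where "c = \<ominus> eval p s"
  have cH: "c \<in> H" and cR: "c \<in> carrier R" and ev_s: "eval p s \<in> carrier R"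
    using c subringE(1,5)[OF sub] by (auto simp: c_def)
  define g where "g = p \<oplus>\<^bsub>poly_ring R\<^esub> poly_of_const c"
  interpret UP: ring "H[X]"
    by (rule univ_poly_is_ring[OF sub])
  have "poly_of_const c \<in> carrier (H[X])"
    using ring_hom_closed[OF canonical_embedding_is_hom[OF sub], of c] cH by simp
  then have gH: "g \<in> carrier (H[X])"
    using UP.a_closed[OF p(1), of "poly_of_const c"] by (simp add: g_def univ_poly_add)
  have gR: "g \<in> carrier (poly_ring R)"
    using carrier_polynomial_shell[OF sub gH] .
  have "degree (poly_of_const c) < degree p"
    using const_poly(2)[OF cR] p(3) by simp
  from monic_add_lower[OF pR p(2) const_poly(1)[OF cR] this]
  have g: "g \<noteq> []" "degree g = degree p"
    by (simp_all add: g_def)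
  have eval_g: "eval g a = eval p a \<oplus> c" if "a \<in> carrier R" for a
    using that eval_add[OF pR const_poly(1)[OF cR] that] const_poly(3)[OF cR that] by (simp add: g_def)
  have "sep_split g"
  proof (rule sep_splitI[OF gR g(1)])
    have "A \<subseteq> {a. is_root g a}"
      using A(1,4) g(1) ev_s by (auto simp: is_root_def eval_g c_def r_neg)
    then show "degree g \<le> card {a. is_root g a}"
      unfolding g(2) using A(3) card_mono[OF finite_number_of_roots[OF gR]] le_trans by blast
  qed
  moreover have "eval g s = \<zero>"
    using eval_g[OF s] ev_s by (simp add: c_def r_neg)
  ultimately show ?thesis
    using s gH by (auto simp: sep_split_over_def)
qed

text \<open>
The roots of \<open>X^n - s^n\<close> are the products of \<open>s\<close> with the \<open>n\<close>-th roots of unity.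
\<close>

lemma sep_split_over_kummer:
  assumes H: "subfield H R" and s: "s \<in> carrier R" "s \<noteq> \<zero>" "s [^] n \<in> H" and n: "n \<ge> 1"
    and Z: "Z \<subseteq> carrier R" "card Z = n" "\<And>\<zeta>. \<zeta> \<in> Z \<Longrightarrow> \<zeta> [^] n = \<one>"
  shows "sep_split_over H s"
proof -
  note sub = subfieldE(1)[OF H]
  have pow: "X [^]\<^bsub>H[X]\<^esub> n = X [^]\<^bsub>poly_ring R\<^esub> n"
    using unitary_monom_eq_var_pow[OF sub] unitary_monom_eq_var_pow[OF carrier_is_subring] by simp
  define p where "p = X [^]\<^bsub>poly_ring R\<^esub> n"
  have p: "p \<in> carrier (H[X])" "lead_coeff p = \<one>" "degree p = n"
    using var_pow_closed[OF sub, of n] monic_pow[OF var_monic(1-3), of n] var_monic(4)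
    by (auto simp: p_def pow)
  have eval_p: "eval p a = a [^] n" if "a \<in> carrier R" for a
    using that var_monic(1) by (simp add: p_def eval_pow eval_var)
  have "finite Z"
    using Z(2) n by (intro card_ge_0_finite) simp
  have "inj_on (\<lambda>\<zeta>. \<zeta> \<otimes> s) Z"
    using Z(1) s(1,2) m_rcancel[of s] by (auto simp: inj_on_def)
  then have card: "card ((\<lambda>\<zeta>. \<zeta> \<otimes> s) ` Z) = n"
    using Z(2) by (simp add: card_image)
  show ?thesis
  proof (rule sep_split_overI[OF H p(1,2) _ s(1)])
    show "(\<lambda>\<zeta>. \<zeta> \<otimes> s) ` Z \<subseteq> carrier R" "finite ((\<lambda>\<zeta>. \<zeta> \<otimes> s) ` Z)" "degree p \<le> card ((\<lambda>\<zeta>. \<zeta> \<otimes> s) ` Z)"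
      using Z(1) s(1) \<open>finite Z\<close> card p(3) by auto
    fix a assume "a \<in> (\<lambda>\<zeta>. \<zeta> \<otimes> s) ` Z"
    then obtain \<zeta> where "\<zeta> \<in> Z" "a = \<zeta> \<otimes> s"
      by blast
    then show "eval p a = eval p s"
      using Z(1,3) s(1) by (auto simp: eval_p nat_pow_distrib)
  qed (use s n p(3) eval_p in auto)
qed

text \<open>
With \<open>q = card F\<close>, the map \<open>v \<mapsto> v^q\<close> is additive and fixes \<open>F\<close>, so \<open>v \<mapsto> v^q + v\<close> is linear over \<open>F\<close>.
\<close>

lemma artin_schreier_linear:
  assumes F: "subfield F R" "finite F" and v: "v \<in> carrier R" and w: "w \<in> carrier R" and b: "b \<in> F"
  shows "(v \<oplus> b \<otimes> w) [^] card F \<oplus> (v \<oplus> b \<otimes> w)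
    = (v [^] card F \<oplus> v) \<oplus> b \<otimes> (w [^] card F \<oplus> w)"
proof -
  have bR: "b \<in> carrier R"
    using b subfieldE(3)[OF F(1)] by blast
  have "(v \<oplus> b \<otimes> w) [^] card F = v [^] card F \<oplus> b \<otimes> w [^] card F"
    using frobenius_add[OF F v, of "b \<otimes> w"] bR w finite_subfield_pow_card(2)[OF F b]
    by (simp add: nat_pow_distrib)
  then show ?thesis
    using bR v w by (simp add: r_distr a_ac)
qed

lemma artin_schreier_poly:
  assumes q: "q > 1"
  obtains u where "u \<in> carrier (poly_ring R)" "\<And>H. subfield H R \<Longrightarrow> u \<in> carrier (H[X])"
    "lead_coeff u = \<one>" "u \<noteq> []" "degree u = q" "\<And>a. a \<in> carrier R \<Longrightarrow> eval u a = a [^] q \<oplus> a"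
proof -
  interpret P: domain "poly_ring R"
    by (rule univ_poly_is_domain[OF carrier_is_subring])
  define u where "u = X [^]\<^bsub>poly_ring R\<^esub> q \<oplus>\<^bsub>poly_ring R\<^esub> X"
  have Xq: "X [^]\<^bsub>poly_ring R\<^esub> q \<in> carrier (poly_ring R)"
    using var_monic(1) by simp
  have uH: "u \<in> carrier (H[X])" if H: "subfield H R" for H
  proof -
    interpret UP: ring "H[X]"
      by (rule univ_poly_is_ring[OF subfieldE(1)[OF H]])
    show ?thesis
      using UP.a_closed[OF var_pow_closed[OF subfieldE(1)[OF H], of q] var_closed(1)[OF subfieldE(1)[OF H]]]
      by (simp add: u_def nat_pow_def univ_poly_add univ_poly_mult univ_poly_one)
  qed
  have "degree X < degree (X [^]\<^bsub>poly_ring R\<^esub> q)"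
    using q monic_pow(3)[OF var_monic(1-3), of q] var_monic(4) by simp
  from monic_add_lower[OF Xq monic_pow(2)[OF var_monic(1-3)] var_monic(1) this]
  have u: "u \<in> carrier (poly_ring R)" "lead_coeff u = \<one>" "u \<noteq> []" "degree u = q"
    using monic_pow(3)[OF var_monic(1-3), of q] var_monic(4) Xq var_monic(1) by (auto simp: u_def)
  have eval_u: "eval u a = a [^] q \<oplus> a" if "a \<in> carrier R" for a
    using eval_add[OF Xq var_monic(1) that] that by (simp add: u_def eval_pow var_monic(1) eval_var)
  show thesis
    using that u uH eval_u by blast
qed

text \<open>
The polynomial \<open>X^q + X\<close> has at most \<open>q\<close> roots, so \<open>N\<close> contains all of them.
\<close>

lemma artin_schreier_kernel:
  assumes q: "q > 1" and N: "N \<subseteq> carrier R" "card N = q" "\<And>e. e \<in> N \<Longrightarrow> e [^] q \<oplus> e = \<zero>"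
    and e: "e \<in> carrier R" "e [^] q \<oplus> e = \<zero>"
  shows "e \<in> N"
proof -
  obtain u where u: "u \<in> carrier (poly_ring R)" "u \<noteq> []" "degree u = q"
    "\<And>a. a \<in> carrier R \<Longrightarrow> eval u a = a [^] q \<oplus> a"
    using artin_schreier_poly[OF q] by metis
  have "N \<subseteq> {a. is_root u a}"
    using N(1,3) u(2,4) by (auto simp: is_root_def)
  moreover have "card {a. is_root u a} \<le> card N"
    using card_roots_le_degree[OF u(1)] u(3) N(2) by simp
  ultimately have "N = {a. is_root u a}"
    using card_seteq[OF finite_number_of_roots[OF u(1)]] by blast
  then show ?thesis
    using e u(2,4) by (auto simp: is_root_def)
qed

text \<open>
Let \<open>q = card F\<close>. What lies in \<open>H\<close> is \<open>c^(q - 1)\<close>, so the polynomial to use is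
\<open>(X^q + X)^(q - 1) - c^(q - 1)\<close>. It is the product of the \<open>X^q + X - a c\<close> over the nonzero
\<open>a\<close> in \<open>F\<close>, and the roots of such a factor are the \<open>e + a s\<close> with \<open>e\<close> in \<open>N\<close>.
\<close>

lemma sep_split_over_artin_schreier:
  assumes H: "subfield H R" and F: "subfield F R" "finite F"
    and N: "N \<subseteq> carrier R" "card N = card F" "\<And>e. e \<in> N \<Longrightarrow> e [^] card F \<oplus> e = \<zero>"
    and s: "s \<in> carrier R" and c: "s [^] card F \<oplus> s = c" "c \<noteq> \<zero>" "c [^] (card F - 1) \<in> H"
  shows "sep_split_over H s"
proof -
  note sub = subfieldE(1)[OF H]
  interpret UP: ring "H[X]"
    by (rule univ_poly_is_ring[OF sub])
  define q where "q = card F"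
  have q: "q > 1"
    using finite_subfield_card_gt_1[OF F] by (simp add: q_def)
  have FR: "F \<subseteq> carrier R"
    using subfieldE(3)[OF F(1)] .
  have pow: "r [^]\<^bsub>H[X]\<^esub> n = r [^]\<^bsub>poly_ring R\<^esub> n" for r and n :: nat
    by (simp add: nat_pow_def univ_poly_mult univ_poly_one)
  obtain u where u: "u \<in> carrier (poly_ring R)" "u \<in> carrier (H[X])" "lead_coeff u = \<one>" "u \<noteq> []"
    "degree u = q" "\<And>a. a \<in> carrier R \<Longrightarrow> eval u a = a [^] q \<oplus> a"
    using artin_schreier_poly[OF q] H by metis
  define p where "p = u [^]\<^bsub>poly_ring R\<^esub> (q - 1)"
  have p: "p \<in> carrier (H[X])" "lead_coeff p = \<one>" "degree p = (q - 1) * q"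
    using UP.nat_pow_closed[OF u(2), of "q - 1"] monic_pow[OF u(1,3,4), of "q - 1"] u(5)
    by (auto simp: p_def pow)
  have eval_p: "eval p a = (a [^] q \<oplus> a) [^] (q - 1)" if "a \<in> carrier R" for a
    using that u(1) by (simp add: p_def eval_pow u(6))
  have cR: "c \<in> carrier R"
    using c(1) s by auto
  define r where "r ae = snd ae \<oplus> fst ae \<otimes> s" for ae
  have r: "r (a, e) \<in> carrier R" "r (a, e) [^] q \<oplus> r (a, e) = a \<otimes> c"
    if "a \<in> F" "e \<in> N" for a e
  proof -
    have ae: "a \<in> carrier R" "e \<in> carrier R"
      using that FR N(1) by auto
    then show "r (a, e) \<in> carrier R"
      using s by (simp add: r_def)
    show "r (a, e) [^] q \<oplus> r (a, e) = a \<otimes> c"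
      using artin_schreier_linear[OF F ae(2) s that(1)] N(3)[OF that(2)] ae(1) cR c(1)
      by (simp add: r_def q_def)
  qed
  define A where "A = r ` ((F - {\<zero>}) \<times> N)"
  have inj: "inj_on r ((F - {\<zero>}) \<times> N)"
  proof (rule inj_onI)
    fix w w' assume w: "w \<in> (F - {\<zero>}) \<times> N" "w' \<in> (F - {\<zero>}) \<times> N" "r w = r w'"
    obtain a e a' e' where ww': "w = (a, e)" "w' = (a', e')"
      by fastforce
    then have ae: "a \<in> F" "e \<in> N" and ae': "a' \<in> F" "e' \<in> N" and eq: "r (a, e) = r (a', e')"
      using w by auto
    have "a \<otimes> c = a' \<otimes> c"
      using r(2)[OF ae] r(2)[OF ae'] eq by simp
    then have "a = a'"
      using c(2) cR ae(1) ae'(1) FR by (metis m_rcancel subsetD)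
    then show "w = w'"
      using eq ae ae' FR N(1) s ww' by (auto simp: r_def subset_iff)
  qed
  have finN: "finite N"
    using N(2) q by (intro card_ge_0_finite) (simp add: q_def)
  have "card (F - {\<zero>}) = q - 1"
    using subringE(2)[OF subfieldE(1)[OF F(1)]] F(2) by (simp add: q_def)
  then have card_A: "card A = (q - 1) * q"
    unfolding A_def card_image[OF inj] by (simp add: card_cartesian_product N(2) q_def)
  have c_pow: "(a \<otimes> c) [^] (q - 1) = c [^] (q - 1)" if "a \<in> F" "a \<noteq> \<zero>" for a
  proof -
    have "a \<in> carrier R"
      using that FR by blast
    then show ?thesis
      using cR finite_subfield_pow_card(1)[OF F that(1)] that(2) by (simp add: nat_pow_distrib q_def)
  qed
  have eval_p_s: "eval p s = c [^] (q - 1)"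
    using eval_p[OF s] c(1) by (simp add: q_def)
  show ?thesis
  proof (rule sep_split_overI[OF H p(1,2) _ s])
    show "A \<subseteq> carrier R" "finite A"
      using r(1) finN F(2) by (auto simp: A_def)
    show "degree p \<ge> 1" "degree p \<le> card A"
      unfolding p(3) card_A using q by simp_all
    show "eval p s \<in> H"
      using c(3) by (simp add: eval_p_s q_def)
    fix w assume "w \<in> A"
    then obtain a e where "a \<in> F" "a \<noteq> \<zero>" "e \<in> N" "w = r (a, e)"
      by (auto simp: A_def)
    then show "eval p w = eval p s"
      unfolding eval_p_s by (simp add: eval_p r c_pow del: One_nat_def)
  qed
qed

lemma linear_poly: "c \<in> carrier R \<Longrightarrow> [\<one>, \<ominus> c] = X \<oplus>\<^bsub>poly_ring R\<^esub> poly_of_const (\<ominus> c)"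
  by (cases "c = \<zero>") (auto simp: var_def univ_poly_add poly_of_const_def)

text \<open>
The cofactor \<open>S\<close> is the sum of the \<open>c^i X^(n - 1 - i)\<close>, given by the recursion \<open>S \<mapsto> X S + c^n\<close>, and
takes the value \<open>n c^(n - 1)\<close> at \<open>c\<close>. The extra factor \<open>c\<close> in the last claim avoids the exponent \<open>n - 1\<close>
for \<open>n = 0\<close>.
\<close>

lemma linear_factor_of_power_difference:
  assumes c: "c \<in> carrier R"
  obtains S where "S \<in> carrier (poly_ring R)"
    "X [^]\<^bsub>poly_ring R\<^esub> (n::nat) \<oplus>\<^bsub>poly_ring R\<^esub> poly_of_const (\<ominus> (c [^] n)) = [\<one>, \<ominus> c] \<otimes>\<^bsub>poly_ring R\<^esub> S"
    "c \<otimes> eval S c = [n] \<cdot> (c [^] n)"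
proof -
  interpret P: domain "poly_ring R"
    by (rule univ_poly_is_domain[OF carrier_is_subring])
  interpret k: ring_hom_ring R "poly_ring R" poly_of_const
    using canonical_embedding_ring_hom[OF carrier_is_subring] by simp
  define l where "l = [\<one>, \<ominus> c]"
  have l_eq: "l = X \<oplus>\<^bsub>poly_ring R\<^esub> \<ominus>\<^bsub>poly_ring R\<^esub> poly_of_const c"
    using linear_poly[OF c] c by (simp add: l_def)
  have X: "X \<in> carrier (poly_ring R)"
    by (rule var_monic(1))
  have kc: "poly_of_const c \<in> carrier (poly_ring R)"
    using c by simp
  have "\<exists>S \<in> carrier (poly_ring R).
    X [^]\<^bsub>poly_ring R\<^esub> n \<oplus>\<^bsub>poly_ring R\<^esub> \<ominus>\<^bsub>poly_ring R\<^esub> (poly_of_const c [^]\<^bsub>poly_ring R\<^esub> n)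
      = l \<otimes>\<^bsub>poly_ring R\<^esub> S \<and> c \<otimes> eval S c = [n] \<cdot> (c [^] n)"
  proof (induction n)
    case 0
    show ?case
    proof (rule bexI[of _ "\<zero>\<^bsub>poly_ring R\<^esub>"])
      have "eval \<zero>\<^bsub>poly_ring R\<^esub> c = \<zero>"
        by (simp add: univ_poly_zero)
      moreover have "l \<in> carrier (poly_ring R)"
        using X kc by (simp add: l_eq)
      ultimately show "X [^]\<^bsub>poly_ring R\<^esub> (0::nat) \<oplus>\<^bsub>poly_ring R\<^esub> \<ominus>\<^bsub>poly_ring R\<^esub> (poly_of_const c [^]\<^bsub>poly_ring R\<^esub> (0::nat))
        = l \<otimes>\<^bsub>poly_ring R\<^esub> \<zero>\<^bsub>poly_ring R\<^esub> \<and> c \<otimes> eval \<zero>\<^bsub>poly_ring R\<^esub> c = [(0::nat)] \<cdot> (c [^] (0::nat))"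
        using c by (simp add: P.r_neg)
    qed simp
  next
    case (Suc n)
    then obtain S where S: "S \<in> carrier (poly_ring R)"
      "X [^]\<^bsub>poly_ring R\<^esub> n \<oplus>\<^bsub>poly_ring R\<^esub> \<ominus>\<^bsub>poly_ring R\<^esub> (poly_of_const c [^]\<^bsub>poly_ring R\<^esub> n) = l \<otimes>\<^bsub>poly_ring R\<^esub> S"
      "c \<otimes> eval S c = [n] \<cdot> (c [^] n)"
      by blast
    define A where "A = X [^]\<^bsub>poly_ring R\<^esub> n"
    define B where "B = poly_of_const c [^]\<^bsub>poly_ring R\<^esub> n"
    define C where "C = poly_of_const c"
    have car: "A \<in> carrier (poly_ring R)" "B \<in> carrier (poly_ring R)" "C \<in> carrier (poly_ring R)" "l \<in> carrier (poly_ring R)"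
      using X kc by (simp_all add: A_def B_def C_def l_eq)
    define T where "T = X \<otimes>\<^bsub>poly_ring R\<^esub> S \<oplus>\<^bsub>poly_ring R\<^esub> B"
    have T: "T \<in> carrier (poly_ring R)"
      using X S(1) car by (simp add: T_def)
    have "l \<otimes>\<^bsub>poly_ring R\<^esub> T = X \<otimes>\<^bsub>poly_ring R\<^esub> (l \<otimes>\<^bsub>poly_ring R\<^esub> S) \<oplus>\<^bsub>poly_ring R\<^esub> l \<otimes>\<^bsub>poly_ring R\<^esub> B"
      using X S(1) car by (simp add: T_def P.r_distr P.m_ac)
    also have "\<dots> = X \<otimes>\<^bsub>poly_ring R\<^esub> (A \<oplus>\<^bsub>poly_ring R\<^esub> \<ominus>\<^bsub>poly_ring R\<^esub> B) \<oplus>\<^bsub>poly_ring R\<^esub> (X \<oplus>\<^bsub>poly_ring R\<^esub> \<ominus>\<^bsub>poly_ring R\<^esub> C) \<otimes>\<^bsub>poly_ring R\<^esub> B"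
      using S(2) by (simp add: A_def B_def C_def l_eq)
    also have "\<dots> = A \<otimes>\<^bsub>poly_ring R\<^esub> X \<oplus>\<^bsub>poly_ring R\<^esub> \<ominus>\<^bsub>poly_ring R\<^esub> (B \<otimes>\<^bsub>poly_ring R\<^esub> C)"
      using X car(1-3) by algebra
    finally have 1: "X [^]\<^bsub>poly_ring R\<^esub> Suc n \<oplus>\<^bsub>poly_ring R\<^esub> \<ominus>\<^bsub>poly_ring R\<^esub> (poly_of_const c [^]\<^bsub>poly_ring R\<^esub> Suc n) = l \<otimes>\<^bsub>poly_ring R\<^esub> T"
      by (simp add: A_def B_def C_def)
    have B_eq: "B = poly_of_const (c [^] n)"
      using c by (simp add: B_def k.hom_nat_pow)
    have SR: "eval S c \<in> carrier R"
      using ring_hom_closed[OF eval_is_hom[OF carrier_is_subring c] S(1)] .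
    have "eval T c = c \<otimes> eval S c \<oplus> c [^] n"
      using eval_add[OF P.m_closed[OF X S(1)] car(2) c] eval_mult[OF X S(1) c] c
        const_poly(3)[of "c [^] n" c] by (simp add: T_def B_eq eval_var)
    then have "c \<otimes> eval T c = c \<otimes> ([n] \<cdot> (c [^] n) \<oplus> c [^] n)"
      using S(3) by simp
    also have "\<dots> = [Suc n] \<cdot> (c [^] n) \<otimes> c"
      using c by (simp add: add.nat_pow_Suc m_comm)
    also have "\<dots> = [Suc n] \<cdot> (c [^] Suc n)"
      using add_pow_ldistr[of "c [^] n" c "Suc n"] c by simp
    finally show ?case
      using 1 T by blast
  qed
  then show thesis
    using that c by (auto simp: k.hom_nat_pow l_def)
qed

text \<open>
A double root \<open>c\<close> of \<open>X^n - 1\<close> would be a root of the cofactor of \<open>X - c\<close>, whose value at \<open>c\<close>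
is \<open>n/c\<close> by the preceding lemma.
\<close>

lemma card_roots_of_unity:
  fixes n :: nat
  assumes n: "n \<ge> 1" "[n] \<cdot> \<one> \<noteq> \<zero>"
    and split: "splitted (X [^]\<^bsub>poly_ring R\<^esub> n \<oplus>\<^bsub>poly_ring R\<^esub> poly_of_const (\<ominus> \<one>))"
  shows "card {\<zeta> \<in> carrier R. \<zeta> [^] n = \<one>} = n"
proof -
  interpret P: domain "poly_ring R"
    by (rule univ_poly_is_domain[OF carrier_is_subring])
  define p where "p = X [^]\<^bsub>poly_ring R\<^esub> n \<oplus>\<^bsub>poly_ring R\<^esub> poly_of_const (\<ominus> \<one>)"
  have Xn: "X [^]\<^bsub>poly_ring R\<^esub> n \<in> carrier (poly_ring R)"
    using var_monic(1) by simp
  have m1: "poly_of_const (\<ominus> \<one>) \<in> carrier (poly_ring R)"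
    by (simp add: const_poly)
  have pR: "p \<in> carrier (poly_ring R)"
    using Xn m1 by (simp add: p_def)
  have "degree (poly_of_const (\<ominus> \<one>)) < degree (X [^]\<^bsub>poly_ring R\<^esub> n)"
    using n(1) const_poly(2)[of "\<ominus> \<one>"] monic_pow(3)[OF var_monic(1-3), of n] var_monic(4) by simp
  from monic_add_lower[OF Xn monic_pow(2)[OF var_monic(1-3)] m1 this]
  have p: "p \<noteq> []" "degree p = n"
    using monic_pow(3)[OF var_monic(1-3), of n] var_monic(4) by (auto simp: p_def)
  have eval_p: "eval p a = a [^] n \<ominus> \<one>" if "a \<in> carrier R" for a
    using eval_add[OF Xn m1 that] const_poly(3)[of "\<ominus> \<one>" a] that
    by (simp add: p_def eval_pow var_monic(1) eval_var a_minus_def)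
  have roots_p: "{a. is_root p a} = {\<zeta> \<in> carrier R. \<zeta> [^] n = \<one>}"
    using p(1) by (auto simp: is_root_def eval_p)
  have "alg_mult p c \<le> 1" for c
  proof (rule ccontr)
    assume mult: "\<not> alg_mult p c \<le> 1"
    then have "is_root p c"
      using alg_mult_gt_zero_iff_is_root[OF pR, of c] by simp
    then have c: "c \<in> carrier R" "c [^] n = \<one>"
      using roots_p by auto
    define l where "l = [\<one>, \<ominus> c]"
    have l: "l \<in> carrier (poly_ring R)" "l \<noteq> []" "eval l c = \<zero>"
      using c(1) by (auto simp flip: univ_poly_carrier simp: l_def polynomial_def r_neg)
    obtain S where S: "S \<in> carrier (poly_ring R)" "p = l \<otimes>\<^bsub>poly_ring R\<^esub> S" "c \<otimes> eval S c = [n] \<cdot> \<one>"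
      using linear_factor_of_power_difference[OF c(1), of n] unfolding c(2) p_def[symmetric] l_def[symmetric] by blast
    have "(l [^]\<^bsub>poly_ring R\<^esub> (2::nat)) pdivides p"
      using le_alg_mult_imp_pdivides[OF c(1) pR, of 2] mult by (simp add: l_def)
    then obtain T where T: "T \<in> carrier (poly_ring R)" "p = l [^]\<^bsub>poly_ring R\<^esub> (2::nat) \<otimes>\<^bsub>poly_ring R\<^esub> T"
      unfolding pdivides_def by (auto elim: dividesE)
    have "l \<otimes>\<^bsub>poly_ring R\<^esub> S = l \<otimes>\<^bsub>poly_ring R\<^esub> (l \<otimes>\<^bsub>poly_ring R\<^esub> T)"
      using S(2) T l(1) by (simp add: numeral_2_eq_2 P.m_assoc)
    then have "S = l \<otimes>\<^bsub>poly_ring R\<^esub> T"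
      using P.m_lcancel[of l S "l \<otimes>\<^bsub>poly_ring R\<^esub> T"] l(1,2) S(1) T(1) by (simp add: univ_poly_zero)
    then have "eval S c = \<zero>"
      using eval_mult[OF l(1) T(1) c(1)] l(3) ring_hom_closed[OF eval_is_hom[OF carrier_is_subring c(1)] T(1)] by simp
    then show False
      using S(3) n(2) c(1) by simp
  qed
  then have "sep_split p"
    using pR p(1) split by (simp add: sep_split_def p_def)
  then show ?thesis
    using sep_split_card_roots p(2) by (simp flip: roots_p)
qed

end

section \<open>Constants in the algebraic closure of a finite field\<close>

context algebraic_closure
begin

lemma pure_poly:
  fixes n :: nat
  assumes a: "a \<in> K" and n: "n \<ge> 1"
  defines "p \<equiv> X [^]\<^bsub>poly_ring L\<^esub> n \<oplus>\<^bsub>poly_ring L\<^esub> poly_of_const (\<ominus> a)"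
  shows "splitted p" "degree p = n" "p \<in> carrier (poly_ring L)"
    "\<And>r. r \<in> carrier L \<Longrightarrow> eval p r = r [^] n \<ominus> a"
proof -
  have K: "subfield K L"
    by (rule subfield_axioms)
  note sub = subfieldE(1)[OF K]
  interpret UP: ring "K[X]"
    by (rule univ_poly_is_ring[OF sub])
  have aK: "\<ominus> a \<in> K" and aL: "\<ominus> a \<in> carrier L" "a \<in> carrier L"
    using a subringE(1,5)[OF sub] by auto
  have "poly_of_const (\<ominus> a) \<in> carrier (K[X])"
    using ring_hom_closed[OF canonical_embedding_is_hom[OF sub], of "\<ominus> a"] aK by simp
  from UP.a_closed[OF var_pow_closed[OF sub, of n] this] have pK: "p \<in> carrier (K[X])"
    by (simp add: p_def nat_pow_def univ_poly_mult univ_poly_one univ_poly_add)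
  then show "splitted p"
    by (rule roots_over_subfield)
  show "p \<in> carrier (poly_ring L)"
    using carrier_polynomial_shell[OF sub pK] .
  interpret P: domain "poly_ring L"
    by (rule univ_poly_is_domain[OF carrier_is_subring])
  have Xn: "X [^]\<^bsub>poly_ring L\<^esub> n \<in> carrier (poly_ring L)"
    using var_monic(1) by simp
  have "degree (poly_of_const (\<ominus> a)) < degree (X [^]\<^bsub>poly_ring L\<^esub> n)"
    using n const_poly(2)[OF aL(1)] monic_pow(3)[OF var_monic(1-3), of n] var_monic(4) by simp
  from monic_add_lower(3)[OF Xn monic_pow(2)[OF var_monic(1-3)] const_poly(1)[OF aL(1)] this]
  show "degree p = n"
    using monic_pow(3)[OF var_monic(1-3), of n] var_monic(4) by (simp add: p_def)
  show "eval p r = r [^] n \<ominus> a" if "r \<in> carrier L" for r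
    using eval_add[OF Xn const_poly(1)[OF aL(1)] that] const_poly(3)[OF aL(1) that] that
    by (simp add: p_def eval_pow var_monic(1) eval_var a_minus_def)
qed

lemma nth_root_exists:
  fixes n :: nat
  assumes a: "a \<in> K" and n: "n \<ge> 1"
  obtains r where "r \<in> carrier L" "r [^] n = a"
proof -
  define p where "p = X [^]\<^bsub>poly_ring L\<^esub> n \<oplus>\<^bsub>poly_ring L\<^esub> poly_of_const (\<ominus> a)"
  note p = pure_poly[OF a n, folded p_def]
  have aL: "a \<in> carrier L"
    using a subfieldE(3)[OF subfield_axioms] by blast
  have "size (roots p) \<noteq> 0"
    using p(1,2) n by (simp add: splitted_def)
  then obtain r where "r \<in># roots p"
    by (metis size_eq_0_iff_empty multiset_nonemptyE)
  then have "r \<in> carrier L" "eval p r = \<zero>"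
    using roots_mem_iff_is_root[OF p(3)] by (auto simp: is_root_def)
  then show thesis
    using that p(4) aL by auto
qed

lemma card_unity_roots:
  fixes n :: nat
  assumes "n \<ge> 1" "coprime n (card K)" "finite K"
  shows "card {\<zeta> \<in> carrier L. \<zeta> [^] n = \<one>} = n"
  using card_roots_of_unity[OF assms(1) finite_subfield_add_pow_nonzero[OF subfield_axioms assms(3,2)]
      pure_poly(1)[OF subringE(3)[OF subfieldE(1)[OF subfield_axioms]] assms(1)]] .

text \<open>
Let \<open>q = card K\<close>. If \<open>c\<close> is a \<open>(q - 1)\<close>-th root of \<open>-1\<close>, then the \<open>q\<close> multiples of \<open>c\<close> by elements of \<open>K\<close> are roots of \<open>X^q + X\<close>.
\<close>

lemma artin_schreier_kernel_exists:
  assumes K: "finite K"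
  obtains N where "N \<subseteq> carrier L" "card N = card K" "\<And>e. e \<in> N \<Longrightarrow> e [^] card K \<oplus> e = \<zero>"
proof -
  have q: "card K > 1"
    by (rule finite_subfield_card_gt_1[OF subfield_axioms K])
  have KL: "K \<subseteq> carrier L"
    using subfieldE(3)[OF subfield_axioms] .
  have "\<ominus> \<one> \<in> K"
    using subringE(3,5)[OF subfieldE(1)[OF subfield_axioms]] by simp
  then obtain c where c: "c \<in> carrier L" "c [^] (card K - 1) = \<ominus> \<one>"
    using nth_root_exists[of "\<ominus> \<one>" "card K - 1"] q by (metis One_nat_def Suc_leI zero_less_diff)
  have c0: "c \<noteq> \<zero>"
  proof
    assume "c = \<zero>"
    then have "\<ominus> \<one> = \<zero>"
      using c(2) q nat_pow_zero[of "card K - 1"] by simp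
    then have "\<ominus> (\<ominus> \<one>) = \<zero>"
      by simp
    then show False
      using KL subringE(3)[OF subfieldE(1)[OF subfield_axioms]] by (simp add: subset_iff)
  qed
  have "c [^] card K = c [^] (card K - 1) \<otimes> c"
    using q nat_pow_Suc[of c "card K - 1"] by simp
  then have cq: "c [^] card K \<oplus> c = \<zero>"
    using c by (simp add: l_minus l_neg)
  show thesis
  proof
    show "(\<lambda>a. a \<otimes> c) ` K \<subseteq> carrier L"
      using KL c(1) by auto
    have "inj_on (\<lambda>a. a \<otimes> c) K"
      using KL c(1) c0 m_rcancel[of c] by (auto simp: inj_on_def)
    then show "card ((\<lambda>a. a \<otimes> c) ` K) = card K"
      by (rule card_image)
    fix e assume "e \<in> (\<lambda>a. a \<otimes> c) ` K"
    then obtain a where a: "a \<in> K" "e = a \<otimes> c"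
      by blast
    then show "e [^] card K \<oplus> e = \<zero>"
      using artin_schreier_linear[OF subfield_axioms K zero_closed c(1) a(1)] KL c(1) cq q
      by (auto simp: nat_pow_zero)
  qed
qed

end

section \<open>The Galois closure\<close>

context field
begin

text \<open>
An element equal to its own inverse is \<open>1\<close> or \<open>-1\<close>, and these two together with \<open>0\<close> do not exhaust \<open>F\<close>.
\<close>

lemma coefficient_not_fixed_by_inverse:
  assumes F: "subfield F R" "card F > 3"
  obtains a where "a \<in> F" "a \<noteq> \<zero>" "a \<ominus> inv a \<noteq> \<zero>"
proof -
  have FR: "F \<subseteq> carrier R"
    using subfieldE(3)[OF F(1)] .
  have "card {\<zero>, \<one>, \<ominus> \<one>} \<le> 3"
    using card_length[of "[\<zero>, \<one>, \<ominus> \<one>]"] by simp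
  then have "\<not> F \<subseteq> {\<zero>, \<one>, \<ominus> \<one>}"
    using F(2) card_mono[of "{\<zero>, \<one>, \<ominus> \<one>}" F] by auto
  then obtain a where a: "a \<in> F" "a \<noteq> \<zero>" "a \<noteq> \<one>" "a \<noteq> \<ominus> \<one>"
    by blast
  have aR: "a \<in> carrier R" "a \<in> Units R"
    using a(1,2) FR by (auto simp: field_Units)
  have "a \<ominus> inv a \<noteq> \<zero>"
  proof
    assume "a \<ominus> inv a = \<zero>"
    then have "a = inv a"
      using aR by simp
    then have "a \<otimes> a = \<one>"
      using Units_r_inv[OF aR(2)] by simp
    then have "a = \<one> \<or> a = \<ominus> \<one>"
      using square_eq_one[OF aR(1)] by blast
    then show False
      using a by blast
  qed
  then show thesis
    using that a by blast
qed

text \<open>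
With \<open>s = r - y/a\<close> the terms in \<open>1/t\<close> cancel and \<open>s^q + s = (a - 1/a) t\<close>. Dividing \<open>s\<close> by \<open>a - 1/a\<close>, which is in
\<open>F\<close>, gives an element of \<open>E\<close> that differs from \<open>z\<close> by a member \<open>e\<close> of the kernel \<open>N\<close>.
\<close>

lemma artin_schreier_root_mem:
  assumes F: "subfield F R" "finite F" and N: "N \<subseteq> carrier R" "card N = card F" "\<And>e. e \<in> N \<Longrightarrow> e [^] card F \<oplus> e = \<zero>"
    and E: "subfield E R" "F \<subseteq> E" "N \<subseteq> E"
    and a: "a \<in> F" "a \<noteq> \<zero>" "a \<ominus> inv a \<noteq> \<zero>" and t: "t \<in> carrier R" "t \<noteq> \<zero>"
    and y: "y \<in> E" "y [^] card F \<oplus> y = t \<oplus> inv t"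
    and r: "r \<in> E" "r [^] card F \<oplus> r = a \<otimes> t \<oplus> inv (a \<otimes> t)"
    and z: "z \<in> carrier R" "z [^] card F \<oplus> z = t"
  shows "z \<in> E"
proof -
  note Fsub = subfieldE(1)[OF F(1)] and Esub = subfieldE(1)[OF E(1)]
  have ER: "E \<subseteq> carrier R"
    using subfieldE(3)[OF E(1)] .
  have inv_a: "inv a \<in> F" "a \<otimes> inv a = \<one>"
    using subfield_m_inv[OF F(1)] a(1,2) by auto
  define b where "b = \<ominus> (inv a)"
  define d where "d = a \<oplus> b"
  define s where "s = r \<oplus> b \<otimes> y"
  have bd: "b \<in> F" "d \<in> F" "d \<noteq> \<zero>"
    using a inv_a subringE(5,7)[OF Fsub] by (auto simp: b_def d_def a_minus_def)
  have inv_d: "inv d \<in> F" "\<ominus> (inv d) \<in> F" "inv d \<otimes> d = \<one>"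
    using subfield_m_inv[OF F(1)] bd subringE(5)[OF Fsub] by auto
  have car: "a \<in> carrier R" "inv a \<in> carrier R" "b \<in> carrier R" "d \<in> carrier R" "inv d \<in> carrier R"
    "y \<in> carrier R" "r \<in> carrier R" "inv t \<in> carrier R" "t \<in> Units R" "a \<in> Units R"
    using a(1,2) inv_a inv_d bd y(1) r(1) t E(2) ER by (auto simp: field_Units)
  have sE: "s \<in> E" and s: "s \<in> carrier R"
    using r(1) y(1) bd(1) E(2) ER subringE(6,7)[OF Esub] by (auto simp: s_def)
  have "(a \<otimes> t) \<otimes> (inv a \<otimes> inv t) = (a \<otimes> inv a) \<otimes> (t \<otimes> inv t)"
    using car(1,2,8) t(1) by (simp add: m_ac)
  also have "\<dots> = \<one>"
    using car(9) inv_a(2) by simp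
  finally have "inv (a \<otimes> t) = inv a \<otimes> inv t"
    using car(1,2,8) t(1) by (intro comm_inv_char) simp_all
  then have "s [^] card F \<oplus> s = (a \<otimes> t \<oplus> inv a \<otimes> inv t) \<oplus> b \<otimes> (t \<oplus> inv t)"
    using artin_schreier_linear[OF F car(7,6) bd(1)] y(2) r(2) by (simp add: s_def)
  also have "\<dots> = d \<otimes> t"
    unfolding d_def b_def using car(1,2,8) t(1) by algebra
  finally have s_as: "s [^] card F \<oplus> s = d \<otimes> t" .
  define e where "e = z \<oplus> (\<ominus> (inv d)) \<otimes> s"
  have "e [^] card F \<oplus> e = t \<oplus> (\<ominus> (inv d)) \<otimes> (d \<otimes> t)"
    using artin_schreier_linear[OF F z(1) s inv_d(2)] z(2) s_as by (simp add: e_def)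
  also have "\<dots> = t \<ominus> (inv d \<otimes> d) \<otimes> t"
    using car(4,5) t(1) by algebra
  also have "\<dots> = \<zero>"
    using t(1) by (simp add: inv_d(3) a_minus_def r_neg)
  finally have e_as: "e [^] card F \<oplus> e = \<zero>" .
  have "e \<in> carrier R"
    using z(1) s car(5) by (simp add: e_def)
  then have "e \<in> E"
    using artin_schreier_kernel[OF finite_subfield_card_gt_1[OF F] N] e_as E(3) by blast
  then have "e \<oplus> inv d \<otimes> s \<in> E"
    using sE inv_d(1) E(2) subringE(6,7)[OF Esub] by blast
  moreover have "e \<oplus> inv d \<otimes> s = z"
    unfolding e_def using z(1) s car(5) by algebra
  ultimately show ?thesis
    by simp
qed

end

theorem proposition3p1:
  fixes L :: "('a, 'b) ring_scheme" (structure)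
    and p h q m :: nat and Fq K :: "'a set" and x y z :: 'a
  assumes "Factorial_Ring.prime p" and "odd p" and "h \<ge> 1" and "q = p ^ h" and "q \<noteq> 3"
    and "m \<ge> 1" and "coprime m p"
    and "field L" and "subfield Fq L" and "card Fq = q"
    and "subfield K L" and "algebraic_closure (L \<lparr> carrier := K \<rparr>) Fq"
    and "x \<in> carrier L" and "((ring.transcendental L) over K) x"
    and "y \<in> carrier L" and "y [^] q \<oplus> y = x [^] m \<oplus> inv (x [^] m)"
    and "z \<in> carrier L" and "z [^] q \<oplus> z = x [^] m"
  shows "is_galois_closure L
           (generate_field L (K \<union> {x [^] (m * (q - 1))}))
           (generate_field L (K \<union> {x, y}))
           (generate_field L (K \<union> {x, y, z}))"
proof -
  interpret L: field L by fact
  interpret A: algebraic_closure "L\<lparr>carrier := K\<rparr>" Fq by fact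
  define n where "n = m * (q - 1)"
  define t where "t = x [^] m"
  define w where "w = y \<ominus> z"
  define u where "u = x [^] n"
  define H where "H = generate_field L (K \<union> {u})"
  define M where "M = generate_field L (K \<union> {x, y, z})"
  define F where "F = generate_field L (K \<union> {x, y})"

  have p: "p \<ge> 3"
    using assms(1,2) prime_ge_2_nat[of p] by (cases "p = 2") auto
  have "q \<ge> p"
    using self_le_power[of p h] p assms(3,4) by simp
  then have q: "q > 3"
    using p assms(5) by simp
  have n: "n \<ge> 1"
    using q assms(6) by (simp add: n_def)
  have "coprime (q - 1) q"
    using q coprime_diff_one_left_nat by simp
  moreover have "coprime m q"
    using assms(4,7) by simp
  ultimately have n_q: "coprime n q"
    by (simp add: n_def)

  have KL: "K \<subseteq> carrier L" and FqL: "Fq \<subseteq> carrier L"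
    using subfieldE(3)[OF assms(11)] subfieldE(3)[OF assms(9)] by blast+
  have FqK: "Fq \<subseteq> K"
    using subfieldE(3)[OF A.subfield_axioms] by simp
  have finFq: "finite Fq"
    using assms(10) q by (intro card_ge_0_finite) simp
  obtain N where N: "N \<subseteq> K" "card N = q" "\<And>e. e \<in> N \<Longrightarrow> e [^] q \<oplus> e = \<zero>"
    using A.artin_schreier_kernel_exists[OF finFq] assms(10) by (auto simp: L.nat_pow_consistent[symmetric])
  define Z where "Z = {\<zeta> \<in> K. \<zeta> [^] n = \<one>}"
  have Z: "Z \<subseteq> K" "card Z = n" "\<And>\<zeta>. \<zeta> \<in> Z \<Longrightarrow> \<zeta> [^] n = \<one>"
    using A.card_unity_roots[OF n _ finFq] n_q assms(10)
    by (auto simp: Z_def L.nat_pow_consistent[symmetric])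
  have root: "\<exists>\<zeta> \<in> K. \<zeta> [^] m = a" if "a \<in> Fq" for a
    using A.nth_root_exists[OF that assms(6)] by (auto simp: L.nat_pow_consistent[symmetric])
  have xyz: "K \<union> {x, y, z} \<subseteq> carrier L"
    using KL assms(13,15,17) by simp
  have M: "subfield M L" "K \<union> {x, y, z} \<subseteq> M"
    using L.generate_fieldE(1,2)[OF xyz M_def] .
  have M_carrier: "M \<subseteq> carrier L"
    using subfieldE(3)[OF M(1)] .
  note Msub = subfieldE(1)[OF M(1)]
  define R where "R = L\<lparr>carrier := M\<rparr>"
  have R_simps [simp]: "carrier R = M" "mult R = mult L" "add R = add L" "one R = one L" "zero R = zero L"
    "R\<lparr>carrier := C\<rparr> = L\<lparr>carrier := C\<rparr>" for C
    by (simp_all add: R_def)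
  have R_pow: "a [^]\<^bsub>R\<^esub> k = a [^] k" for a and k :: nat
    by (simp add: nat_pow_def)
  interpret R: field R
    unfolding R_def using L.subfield_iff(2)[OF M(1)] .
  have R_sub: "subfield C R" if "subfield C L" "C \<subseteq> M" for C
    using R.subfield_iff(1)[of C] L.subfield_iff(2)[OF that(1)] that(2) by simp
  have R_gen: "generate_field R C = generate_field L C" if "C \<subseteq> M" for C
    using L.subfield_gen_equality[OF M(1) that] by (simp add: R_def)

  have xM: "x \<in> M" and yM: "y \<in> M" and zM: "z \<in> M" and KM: "K \<subseteq> M"
    using M(2) by auto
  have tM: "t \<in> M" and uM: "u \<in> M"
    using R.nat_pow_closed[of x] xM by (simp_all add: R_pow t_def u_def)
  have "K \<union> {u} \<subseteq> M"
    using KM uM by simp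
  then have H: "subfield H L" "K \<union> {u} \<subseteq> H" "H \<subseteq> M"
    using L.generate_fieldE[OF _ H_def] M_carrier M(1) by blast+
  have HR: "subfield H R"
    using R_sub[OF H(1,3)] .
  have FqR: "subfield Fq R" and KR: "subfield K R"
    using R_sub assms(9,11) FqK KM by auto
  have x0: "x \<noteq> \<zero>"
    using assms(14) L.zero_is_algebraic[OF subfieldE(1)[OF assms(11)]] by (auto simp: over_def)
  have xL: "x \<in> carrier L" and tL: "t \<in> carrier L" and uL: "u \<in> carrier L"
    using assms(13) by (simp_all add: t_def u_def)
  have nz_pow: "x [^] k \<noteq> \<zero>" for k :: nat
    using x0 xL by (induction k) (auto simp: L.integral_iff)
  have t0: "t \<noteq> \<zero>" and u0: "u \<noteq> \<zero>"
    using nz_pow by (simp_all add: t_def u_def)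
  have tu: "t [^] (q - 1) = u"
    using xL by (simp add: t_def u_def n_def L.nat_pow_pow)
  have tU: "t \<in> Units L"
    using tL t0 by (simp add: L.field_Units)
  have inv_tM: "inv t \<in> M"
    using L.subfield_m_inv(1)[OF M(1)] tM t0 by simp
  have wM: "w \<in> M"
    using yM zM subringE(5,7)[OF Msub] by (auto simp: w_def a_minus_def)
  (* w = y + (-1) z is a combination with coefficient in Fq, so w is again an Artin-Schreier element. *)
  have m1: "\<ominus> \<one> \<in> Fq"
    using subringE(3,5)[OF subfieldE(1)[OF assms(9)]] by simp
  have "w = y \<oplus> (\<ominus> \<one>) \<otimes> z"
    using assms(15,17) by (simp add: w_def a_minus_def L.l_minus)
  then have "w [^] q \<oplus> w = (t \<oplus> inv t) \<oplus> (\<ominus> \<one>) \<otimes> t"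
    using L.artin_schreier_linear[OF assms(9) finFq assms(15,17) m1] assms(10,16,18) by (simp add: t_def)
  also have "\<dots> = inv t"
    using tL L.Units_inv_closed[OF tU] by algebra
  finally have w_as: "w [^] q \<oplus> w = inv t" .
  have "(inv t) [^] (q - 1) \<otimes> u = (inv t \<otimes> t) [^] (q - 1)"
    using L.nat_pow_distrib[of "inv t" t "q - 1"] tL L.Units_inv_closed[OF tU] tu by simp
  then have "u \<otimes> (inv t) [^] (q - 1) = \<one>"
    using tU uL by (simp add: L.m_comm)
  then have "inv u = (inv t) [^] (q - 1)"
    using uL tU by (intro L.comm_inv_char) simp_all
  then have inv_tu: "(inv t) [^] (q - 1) \<in> H"
    using L.subfield_m_inv(1)[OF H(1), of u] H(2) u0 by simp

  have split: "R.sep_split_over H s" if "s \<in> {x, z, w}" for s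
  proof -
    have "R.sep_split_over H x"
      using R.sep_split_over_kummer[OF HR, of x n Z] xM x0 H(2) n Z KM by (auto simp: R_pow u_def)
    moreover have "R.sep_split_over H z"
      using R.sep_split_over_artin_schreier[OF HR FqR finFq, of N z t] N KM zM t0 tu H(2) assms(10,18)
      by (auto simp: R_pow t_def)
    moreover have "R.sep_split_over H w"
      using R.sep_split_over_artin_schreier[OF HR FqR finFq, of N w "inv t"] N KM wM w_as inv_tu assms(10) tU
        L.Units_inv_Units[OF tU] by (auto simp: R_pow L.field_Units)
    ultimately show ?thesis
      using that by blast
  qed

  have xzw: "H \<union> {x, z, w} \<subseteq> M"
    using H(3) xM zM wM by simp
  have gen: "generate_field R (H \<union> {x, z, w}) = M"
  proof
    show "generate_field R (H \<union> {x, z, w}) \<subseteq> M"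
      using R.generate_field_incl[of "H \<union> {x, z, w}"] xzw by simp
    define G where "G = generate_field L (H \<union> {x, z, w})"
    have G: "subfield G L" "H \<union> {x, z, w} \<subseteq> G"
      using L.generate_fieldE(1,2)[OF _ G_def] xzw M_carrier by auto
    have "y = w \<oplus> z"
      unfolding w_def using assms(15,17) by algebra
    then have "y \<in> G"
      using G(2) subringE(7)[OF subfieldE(1)[OF G(1)]] by auto
    then show "M \<subseteq> generate_field R (H \<union> {x, z, w})"
      unfolding R_gen[OF xzw] M_def G_def[symmetric] using G H(2)
      by (intro L.generate_field_min_subfield1[OF xyz]) auto
  qed

  have galois: "galois_extension R H"
  proof (rule R.galois_extension_generated[OF HR _ split])
    show "generate_field R (H \<union> {x, z, w}) = carrier R"
      using gen by simp
  qed simp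

  have minimal: "M \<subseteq> E" if E: "subfield E L" "F \<subseteq> E" "galois_extension (L\<lparr>carrier := E\<rparr>) H" for E
  proof -
    have "K \<union> {x, y} \<subseteq> F"
      using L.generate_fieldE(2)[OF _ F_def] xyz by auto
    then have KE: "K \<subseteq> E" and xE: "x \<in> E" and yE: "y \<in> E"
      using E(2) by auto
    note Esub = subfieldE(1)[OF E(1)]
    obtain a where a: "a \<in> Fq" "a \<noteq> \<zero>" "a \<ominus> inv a \<noteq> \<zero>"
      using L.coefficient_not_fixed_by_inverse[OF assms(9)] assms(10) q by auto
    obtain \<zeta> where \<zeta>: "\<zeta> \<in> K" "\<zeta> [^] m = a"
      using root[OF a(1)] by blast
    have aL: "a \<in> carrier L" and \<zeta>L: "\<zeta> \<in> carrier L"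
      using a(1) \<zeta>(1) FqL KL by auto
    have \<zeta>0: "\<zeta> \<noteq> \<zero>"
      using a(2) \<zeta>(2) assms(6) L.nat_pow_zero[of m] by auto
    have \<zeta>n: "\<zeta> [^] n = \<one>"
      using \<zeta>(2) \<zeta>L L.finite_subfield_pow_card(1)[OF assms(9) finFq a(1)] a(2) assms(10)
      by (simp add: n_def flip: L.nat_pow_pow)

    have trans: "(R.transcendental over K) x"
      using assms(14) L.transcendental_consistent[OF Msub] by (simp add: R_def over_def)
    (* \<tau> extends the substitution x \<mapsto> \<zeta> x on K(x), which fixes u because \<zeta>^n = 1. *)
    define E1 where "E1 = generate_field R (insert x K)"
    have xK: "insert x K \<subseteq> carrier R"
      using xM KM by simp
    have E1: "subfield E1 R" "insert x K \<subseteq> E1"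
      using R.generate_fieldE(1,2)[OF xK E1_def] .
    obtain \<phi> where \<phi>: "\<phi> \<in> ring_hom (R\<lparr>carrier := E1\<rparr>) R" "\<phi> x = \<zeta> \<otimes> x" "\<And>k. k \<in> K \<Longrightarrow> \<phi> k = k"
      using R.scaling_hom[OF KR _ trans \<zeta>(1)] xM \<zeta>0 unfolding E1_def by auto
    interpret \<phi>: ring_hom_ring "R\<lparr>carrier := E1\<rparr>" R \<phi>
      using R.subring_is_ring[OF subfieldE(1)[OF E1(1)]] R.ring_axioms \<phi>(1) by (rule ring_hom_ringI2)
    have "u \<in> E1"
      using \<phi>.R.nat_pow_closed[of x n] E1(2) by (simp add: u_def nat_pow_def)
    moreover have "\<phi> u = (\<zeta> \<otimes> x) [^] n"
      using \<phi>.hom_nat_pow[of x n] E1(2) \<phi>(2) by (simp add: u_def nat_pow_def)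
    then have "\<phi> u = u"
      using \<zeta>L xL \<zeta>n by (simp add: L.nat_pow_distrib u_def)
    moreover have H_gen: "H = generate_field R (K \<union> {u})"
      using R_gen KM uM by (simp add: H_def)
    ultimately have \<phi>H: "\<phi> e = e" if "e \<in> H" for e
      using R.hom_fixes_generated[OF E1(1) \<phi>(1), of "K \<union> {u}" e] E1(2) \<phi>(3) that by auto
    have HE1: "H \<subseteq> E1"
      unfolding H_gen using \<open>u \<in> E1\<close> E1(2) KM uM by (intro R.generate_field_min_subfield1[OF _ E1(1)]) auto
    obtain \<tau> where \<tau>: "\<tau> \<in> ring_hom (R\<lparr>carrier := generate_field R (E1 \<union> {z, w})\<rparr>) R"
      "\<And>e. e \<in> E1 \<Longrightarrow> \<tau> e = \<phi> e"
      using R.extend_hom_to_generated[OF HR E1(1) HE1 \<phi>(1) \<phi>H, of "{z, w}"] split by blast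
    have E1zw: "E1 \<union> {z, w} \<subseteq> carrier R"
      using subfieldE(3)[OF E1(1)] zM wM by simp
    have "generate_field R (E1 \<union> {z, w}) = carrier R"
    proof
      show "generate_field R (E1 \<union> {z, w}) \<subseteq> carrier R"
        using R.generate_field_incl[OF E1zw] .
      show "carrier R \<subseteq> generate_field R (E1 \<union> {z, w})"
        using R.mono_generate_field[OF _ E1zw, of "H \<union> {x, z, w}"] HE1 E1(2) gen by auto
    qed
    then have \<tau>_hom: "\<tau> \<in> ring_hom R R"
      using \<tau>(1) by (simp add: R_def)
    interpret \<tau>: ring_hom_ring R R \<tau>
      using R.ring_axioms R.ring_axioms \<tau>_hom by (rule ring_hom_ringI2)
    have \<tau>x: "\<tau> x = \<zeta> \<otimes> x" and \<tau>H: "\<And>e. e \<in> H \<Longrightarrow> \<tau> e = e"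
      using \<tau>(2) \<phi>(2) \<phi>H E1(2) HE1 by auto
    have \<tau>t: "\<tau> t = a \<otimes> t"
      using \<tau>.hom_nat_pow[of x m] xM \<tau>x \<zeta>(2) \<zeta>L xL by (simp add: t_def R_pow L.nat_pow_distrib)
    have atL: "a \<otimes> t \<in> carrier L"
      using aL tL by simp
    have "\<tau> t \<otimes> \<tau> (inv t) = \<tau> (t \<otimes> inv t)"
      using \<tau>.hom_mult[of t "inv t"] tM inv_tM by simp
    also have "\<dots> = \<one>"
      using \<tau>.hom_one tU by simp
    finally have \<tau>_inv: "\<tau> (inv t) = inv (a \<otimes> t)"
      using atL \<tau>.hom_closed[of "inv t"] inv_tM M_carrier unfolding \<tau>t by (intro L.comm_inv_char[symmetric]) auto
    define r where "r = \<tau> y"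
    have r: "r \<in> M"
      using \<tau>.hom_closed[of y] yM by (simp add: r_def)
    have yq: "y [^] q \<in> M"
      using R.nat_pow_closed[of y q] yM by (simp add: R_pow)
    have "r [^] q \<oplus> r = \<tau> (y [^] q \<oplus> y)"
      using \<tau>.hom_add[of "y [^] q" y] \<tau>.hom_nat_pow[of y q] yM yq by (simp add: r_def R_pow)
    also have "\<dots> = a \<otimes> t \<oplus> inv (a \<otimes> t)"
      using \<tau>.hom_add[of t "inv t"] tM inv_tM assms(16) \<tau>t \<tau>_inv by (simp add: t_def)
    finally have r_as: "r [^] q \<oplus> r = a \<otimes> t \<oplus> inv (a \<otimes> t)" .

    interpret E: galois_extension "L\<lparr>carrier := E\<rparr>" H
      by fact
    (* The minimal polynomial is taken in E, where normality applies; \<tau> y is a root of it in M. *)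
    define f where "f = E.Irr H y"
    have f: "f \<in> carrier (H[X]\<^bsub>L\<^esub>)" "L.eval f y = \<zero>" "f \<noteq> []"
      using E.IrrE(1,4)[OF E.subfield_axioms _ E.algebraic] E.degree_Irr_pos[OF E.subfield_axioms _ E.algebraic, of y] yE
      by (auto simp: f_def L.univ_poly_consistent[OF Esub] L.eval_consistent[OF Esub])
    have HE: "H \<subseteq> E"
      using subfieldE(3)[OF E.subfield_axioms] by simp
    have set_f: "set f \<subseteq> H"
      using f(1) L.polynomial_incl by (simp flip: univ_poly_carrier)
    have "\<tau> (R.eval f y) = R.eval (map \<tau> f) r"
      using \<tau>.eval_hom'[of y f] yM set_f H(3) by (auto simp: r_def)
    moreover have "map \<tau> f = f"
      using \<tau>H set_f by (intro map_idI) blast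
    moreover have "R.eval = L.eval"
      using L.eval_consistent[OF Msub] by (simp add: R_def)
    ultimately have "L.eval f r = \<zero>"
      using f(2) \<tau>.hom_zero by simp
    moreover have "f \<in> carrier (E[X]\<^bsub>L\<^esub>)"
      using f(1) L.carrier_poly_mono[OF HE] by blast
    moreover have "r \<in> carrier L"
      using r M_carrier by blast
    ultimately have "r \<in> E"
      using L.root_mem_of_split[OF E(1), of f r] E.normal[of y] E.separable[of y] yE f(3) by (auto simp: f_def)
    then have "z \<in> E"
      using L.artin_schreier_root_mem[OF assms(9) finFq, of N E a t y r z] N a tL t0 yE r_as assms(10,16,17,18)
        KL KE FqK E(1) by (auto simp: t_def)
    then show "M \<subseteq> E"
      unfolding M_def using KE xE yE by (intro L.generate_field_min_subfield1[OF xyz E(1)]) auto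
  qed

  have "F \<subseteq> M"
    unfolding F_def M_def by (rule L.mono_generate_field[OF _ xyz]) auto
  then have "is_galois_closure L H F M"
    unfolding is_galois_closure_def using M(1) galois minimal by (simp add: R_def)
  then show ?thesis
    by (simp add: H_def F_def M_def u_def n_def)
qed

end
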